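(* Let $(\Omega^\bullet,\wedge,d)$ be a $\ast$-differential calculus on a unital $\ast$-algebra $B$ over $\mathbb{C}$, let $(g,(\ ,\ ))$ be a real metric on $\Omega^1$, and let $(\nabla,\sigma)$ be a $\ast$-preserving (left) bimodule connection on $\Omega^1$ such that $\sigma:\Omega^1\otimes_B\Omega^1\to\Omega^1\otimes_B\Omega^1$ is an isomorphism. Define the sesquilinear form ${}_B\langle\langle\eta,\omega\rangle\rangle:=(\eta,\omega^\ast)$ on $\Omega^1$. Then the following statements are equivalent: (i) $\nabla$ is compatible with $(g,(\ ,\ ))$, i.e. $\nabla_{\Omega^1\otimes_B\Omega^1}(g)=0$. (ii) The connection $\nabla'=\sqrt{-1}\,\nabla$ for the first order differential calculus $(\Omega^1,d')$, $d'=\sqrt{-1}\,d$, is Hermitian with respect to the weak $\dagger$-bimodule $(\Omega^1,\dagger,{}_B\langle\langle\ ,\ \rangle\rangle)$ with $\dagger(\omega)=\omega^\ast$, i.e. for all $e,f\in\Omega^1$, $$d'\big({}_B\langle\langle e,f\rangle\rangle\big)={}_{\Omega^1}\langle\langle\nabla'(e),f\rangle\rangle-{}_{\Omega^1}\langle\langle e,\nabla'(f)\rangle\rangle .$$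
   Context: Algebras are unital over $\mathbb{C}$. A differential calculus on $B$ is a differential graded algebra $(\Omega^\bullet=\bigoplus_{k\ge0}\Omega^k,\wedge,d)$ with $\Omega^0=B$, generated as an algebra by $B$ and $dB$. For a $\ast$-algebra $B$ it is a $\ast$-differential calculus if there is a conjugate-linear involution $\ast$ on $\Omega^\bullet$ extending that of $B$, preserving degrees, with $(d\omega)^\ast=d(\omega^\ast)$ and $(\omega\wedge\nu)^\ast=(-1)^{kl}\nu^\ast\wedge\omega^\ast$ for $\omega\in\Omega^k$, $\nu\in\Omega^l$. A (left) connection on a $B$-bimodule $\mathcal E$ is a $\mathbb{C}$-linear map $\nabla:\mathcal E\to\Omega^1\otimes_B\mathcal E$ with $\nabla(be)=b\nabla(e)+db\otimes_Be$. It is a bimodule connection $(\nabla,\sigma)$ if $\sigma:\mathcal E\otimes_B\Omega^1\to\Omega^1\otimes_B\mathcal E$ is a $B$-bimodule map with $\nabla(eb)=\nabla(e)b+\sigma(e\otimes_Bdb)$. A bimodule connection $(\nabla,\sigma)$ on $\Omega^1$ induces the connection $\nabla_{\Omega^1\otimes_B\Omega^1}=\nabla\otimes_B\mathrm{id}+(\sigma\otimes_B\mathrm{id})(\mathrm{id}\otimes_B\nabla)$ on $\Omega^1\otimes_B\Omega^1$. It is $\ast$-preserving if for every $e\in\Omega^1$ with $\nabla(e)=\sum_i\omega_i\otimes_Be_i$ one has $\nabla(e^\ast)=\sigma\big(\sum_ie_i^\ast\otimes_B\omega_i^\ast\big)$. A metric on $\Omega^1$ is a pair $(g,(\ ,\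 ))$ with $g\in\Omega^1\otimes_B\Omega^1$ and $(\ ,\ ):\Omega^1\otimes_B\Omega^1\to B$ a $B$-bilinear map such that $((\omega,\ )\otimes_B\mathrm{id})g=\omega=(\mathrm{id}\otimes_B(\ ,\omega))g$ for all $\omega\in\Omega^1$. Writing $g=\sum_i\omega_i\otimes_B\eta_i$, it is real if $g=\sum_i\eta_i^\ast\otimes_B\omega_i^\ast$. A sesquilinear form on a $B$-bimodule $\mathcal E$ is a map ${}_B\langle\langle\ ,\ \rangle\rangle:\mathcal E\times\mathcal E\to B$, left $B$-linear in the first variable, $\mathbb{C}$-antilinear in the second, with ${}_B\langle\langle e,f\rangle\rangle={}_B\langle\langle f,e\rangle\rangle^\ast$. A weak $\dagger$-bimodule $(X,\dagger,{}_B\langle\langle\ ,\ \rangle\rangle)$ is a $B$-bimodule $X$, finitely generated projective as a left module, with an antilinear involution $\dagger$ satisfying $\dagger(bxc)=c^\ast\dagger(x)b^\ast$ and a sesquilinear form with ${}_B\langle\langle xb,y\rangle\rangle={}_B\langle\langle x,yb^\ast\rangle\rangle$. (For a real metric on $\Omega^1$ the triple in (ii) is a weak $\dagger$-bimodule.) The pairings in (ii) are ${}_{\Omega^1}\langle\langle\omega\otimes_Be,f\rangle\rangle=\omega\,{}_B\langle\langle e,f\rangle\rangle$ and ${}_{\Omega^1}\langle\langle e,\omega\otimes_Bf\rangle\rangle={}_B\langle\langle e,f\rangle\rangle\,\dagger(\omega)$. *)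

theory Defs
  imports Complex_Main "HOL-Library.Poly_Mapping"
begin

section \<open>Unital complex algebras and differential calculi\<close>

class complex_vec = ab_group_add +
  fixes scaleC :: "complex \<Rightarrow> 'a \<Rightarrow> 'a" (infixr "*\<^sub>C" 75)
  assumes scaleC_add_right: "c *\<^sub>C (x + y) = c *\<^sub>C x + c *\<^sub>C y"
    and scaleC_add_left: "(c + c') *\<^sub>C x = c *\<^sub>C x + c' *\<^sub>C x"
    and scaleC_scaleC: "c *\<^sub>C (c' *\<^sub>C x) = (c * c') *\<^sub>C x"
    and scaleC_one: "1 *\<^sub>C x = x"

text \<open>The sort \<^class>\<open>ring\<close> + \<^class>\<open>monoid_mult\<close> is used instead of \<^class>\<open>ring_1\<close>,
  because the latter excludes the zero algebra.\<close>

class complex_algebra_1 = ring + monoid_mult + complex_vec +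
  assumes mult_scaleC_left: "(c *\<^sub>C x) * y = c *\<^sub>C (x * y)"
    and mult_scaleC_right: "x * (c *\<^sub>C y) = c *\<^sub>C (x * y)"
begin

definition is_subspace :: "'a set \<Rightarrow> bool" where
  "is_subspace A \<longleftrightarrow> 0 \<in> A \<and> (\<forall>x\<in>A. \<forall>y\<in>A. x + y \<in> A) \<and> (\<forall>c. \<forall>x\<in>A. c *\<^sub>C x \<in> A)"

definition is_subalgebra :: "'a set \<Rightarrow> bool" where
  "is_subalgebra A \<longleftrightarrow> is_subspace A \<and> 1 \<in> A \<and> (\<forall>x\<in>A. \<forall>y\<in>A. x * y \<in> A)"

end

text \<open>A type of this class is the total algebra \<open>\<Omega>\<^sup>\<bullet>\<close> with \<open>\<wedge>\<close> written \<open>*\<close>;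
  \<open>grade k\<close> is \<open>\<Omega>\<^sup>k\<close>, and the algebra \<open>B\<close> is \<open>grade 0\<close>.\<close>

class differential_calculus = complex_algebra_1 +
  fixes grade :: "nat \<Rightarrow> 'a set"
    and ext_d :: "'a \<Rightarrow> 'a"
  assumes grade_subspace: "is_subspace (grade k)"
    and grade_direct_sum:
      "\<exists>!c. (\<forall>k. c k \<in> grade k) \<and> finite {k. c k \<noteq> 0} \<and> x = (\<Sum>k | c k \<noteq> 0. c k)"
    and grade_one: "1 \<in> grade 0"
    and grade_mult: "x \<in> grade k \<Longrightarrow> y \<in> grade l \<Longrightarrow> x * y \<in> grade (k + l)"
    and ext_d_add: "ext_d (x + y) = ext_d x + ext_d y"
    and ext_d_scaleC: "ext_d (c *\<^sub>C x) = c *\<^sub>C ext_d x"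
    and ext_d_grade: "x \<in> grade k \<Longrightarrow> ext_d x \<in> grade (Suc k)"
    and ext_d_ext_d: "ext_d (ext_d x) = 0"
    and ext_d_mult: "x \<in> grade k \<Longrightarrow> ext_d (x * y) = ext_d x * y + (-1) ^ k *\<^sub>C (x * ext_d y)"
    and generated: "is_subalgebra A \<Longrightarrow> grade 0 \<union> ext_d ` grade 0 \<subseteq> A \<Longrightarrow> A = UNIV"

class has_star =
  fixes cstar :: "'a \<Rightarrow> 'a"

text \<open>The case \<open>k = l = 0\<close> of \<open>cstar_mult\<close> makes \<open>B\<close> a unital \<open>*\<close>-algebra.\<close>

class star_differential_calculus = differential_calculus + has_star +
  assumes cstar_add: "cstar (x + y) = cstar x + cstar y"
    and cstar_scaleC: "cstar (c *\<^sub>C x) = cnj c *\<^sub>C cstar x"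
    and cstar_cstar: "cstar (cstar x) = x"
    and cstar_grade: "x \<in> grade k \<Longrightarrow> cstar x \<in> grade k"
    and cstar_ext_d: "cstar (ext_d x) = ext_d (cstar x)"
    and cstar_mult: "x \<in> grade k \<Longrightarrow> y \<in> grade l \<Longrightarrow>
      cstar (x * y) = (-1) ^ (k * l) *\<^sub>C (cstar y * cstar x)"

lemma scaleC_zero_left: "0 *\<^sub>C (x :: 'a::complex_vec) = 0"
  using scaleC_add_left[of 0 0 x] by simp

lemma scaleC_minus_one: "(-1) *\<^sub>C (x :: 'a::complex_vec) = - x"
proof -
  have "x + (-1) *\<^sub>C x = (1 + (-1)) *\<^sub>C x"
    by (simp only: scaleC_add_left scaleC_one)
  then have "x + (-1) *\<^sub>C x = 0"
    by (simp add: scaleC_zero_left)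
  then show ?thesis
    by (metis add.inverse_unique)
qed

lemma grade_zero_mem: "(0 :: 'a::differential_calculus) \<in> grade k"
  and grade_add_mem: "x \<in> grade k \<Longrightarrow> y \<in> grade k \<Longrightarrow> (x + y :: 'a) \<in> grade k"
  and grade_scaleC_mem: "x \<in> grade k \<Longrightarrow> (c *\<^sub>C x :: 'a) \<in> grade k"
  using grade_subspace[of k, where 'a='a] by (auto simp: is_subspace_def)

lemma grade_uminus_mem: "x \<in> grade k \<Longrightarrow> (- x :: 'a::differential_calculus) \<in> grade k"
  using grade_scaleC_mem[of x k "-1"] by (simp add: scaleC_minus_one)

lemma grade_minus_mem:
  "x \<in> grade k \<Longrightarrow> y \<in> grade k \<Longrightarrow> (x - y :: 'a::differential_calculus) \<in> grade k"
  using grade_add_mem[of x k "- y"] grade_uminus_mem[of y k] by simp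


section \<open>The algebra \<open>B\<close> and the bimodule \<open>\<Omega>\<^sup>1\<close>\<close>

typedef (overloaded) 'a form0 = "grade 0 :: 'a::star_differential_calculus set"
  using grade_zero_mem by blast

typedef (overloaded) 'a form1 = "grade 1 :: 'a::star_differential_calculus set"
  using grade_zero_mem by blast

setup_lifting type_definition_form0
setup_lifting type_definition_form1

instantiation form0 :: (star_differential_calculus) "{complex_algebra_1, has_star}"
begin

lift_definition zero_form0 :: "'a form0" is 0 by (rule grade_zero_mem)
lift_definition one_form0 :: "'a form0" is 1 by (rule grade_one)
lift_definition plus_form0 :: "'a form0 \<Rightarrow> 'a form0 \<Rightarrow> 'a form0" is "(+)" by (rule grade_add_mem)
lift_definition minus_form0 :: "'a form0 \<Rightarrow> 'a form0 \<Rightarrow> 'a form0" is "(-)" by (rule grade_minus_mem)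
lift_definition uminus_form0 :: "'a form0 \<Rightarrow> 'a form0" is uminus by (rule grade_uminus_mem)
lift_definition times_form0 :: "'a form0 \<Rightarrow> 'a form0 \<Rightarrow> 'a form0" is "(*)"
  using grade_mult[where k=0 and l=0] by simp
lift_definition scaleC_form0 :: "complex \<Rightarrow> 'a form0 \<Rightarrow> 'a form0" is scaleC by (rule grade_scaleC_mem)
lift_definition cstar_form0 :: "'a form0 \<Rightarrow> 'a form0" is cstar by (rule cstar_grade)

instance
  by standard
    (transfer; simp add: algebra_simps scaleC_add_right scaleC_add_left scaleC_scaleC scaleC_one
      mult_scaleC_left mult_scaleC_right)+

end

instantiation form1 :: (star_differential_calculus) "{complex_vec, has_star}"
begin

lift_definition zero_form1 :: "'a form1" is 0 by (rule grade_zero_mem)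
lift_definition plus_form1 :: "'a form1 \<Rightarrow> 'a form1 \<Rightarrow> 'a form1" is "(+)" by (rule grade_add_mem)
lift_definition minus_form1 :: "'a form1 \<Rightarrow> 'a form1 \<Rightarrow> 'a form1" is "(-)" by (rule grade_minus_mem)
lift_definition uminus_form1 :: "'a form1 \<Rightarrow> 'a form1" is uminus by (rule grade_uminus_mem)
lift_definition scaleC_form1 :: "complex \<Rightarrow> 'a form1 \<Rightarrow> 'a form1" is scaleC by (rule grade_scaleC_mem)
lift_definition cstar_form1 :: "'a form1 \<Rightarrow> 'a form1" is cstar by (rule cstar_grade)

instance
  by standard
    (transfer; simp add: algebra_simps scaleC_add_right scaleC_add_left scaleC_scaleC scaleC_one)+

end

lift_definition lact :: "'a::star_differential_calculus form0 \<Rightarrow> 'a form1 \<Rightarrow> 'a form1" (infixr "\<rhd>" 72)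
  is "(*)" using grade_mult[where k=0 and l=1] by simp

lift_definition ract :: "'a::star_differential_calculus form1 \<Rightarrow> 'a form0 \<Rightarrow> 'a form1" (infixl "\<lhd>" 72)
  is "(*)" using grade_mult[where k=1 and l=0] by simp

lift_definition ext_d0 :: "'a::star_differential_calculus form0 \<Rightarrow> 'a form1" is ext_d
  using ext_d_grade[where k=0] by simp

lemma lact_add_right: "b \<rhd> (x + y) = b \<rhd> x + b \<rhd> y" by transfer (simp add: algebra_simps)
lemma lact_add_left: "(b + c) \<rhd> x = b \<rhd> x + c \<rhd> x" by transfer (simp add: algebra_simps)
lemma lact_lact: "b \<rhd> (c \<rhd> x) = (b * c) \<rhd> x" by transfer (simp add: mult.assoc)
lemma lact_one: "1 \<rhd> x = x" by transfer simp
lemma ract_add_left: "(x + y) \<lhd> b = x \<lhd> b + y \<lhd> b" by transfer (simp add: algebra_simps)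
lemma ract_add_right: "x \<lhd> (b + c) = x \<lhd> b + x \<lhd> c" by transfer (simp add: algebra_simps)
lemma ract_ract: "(x \<lhd> b) \<lhd> c = x \<lhd> (b * c)" by transfer (simp add: mult.assoc)
lemma ract_one: "x \<lhd> 1 = x" by transfer simp
lemma lact_ract: "(b \<rhd> x) \<lhd> c = b \<rhd> (x \<lhd> c)" by transfer (simp add: mult.assoc)
lemma scaleC_ract: "(c *\<^sub>C x) \<lhd> b = c *\<^sub>C (x \<lhd> b)" by transfer (simp add: mult_scaleC_left)


lifting_forget form0.lifting
lifting_forget form1.lifting


section \<open>Tensor products over \<open>B\<close>\<close>

text \<open>For a right module \<open>M\<close> with action \<open>r\<close> and a left module \<open>N\<close> with action \<open>l\<close> over the same
  algebra, \<open>M \<otimes>\<^sub>B N\<close> is the free abelian group on \<open>M \<times> N\<close> modulo the following subgroup.\<close>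

inductive_set tensor_relations ::
    "('m::ab_group_add \<Rightarrow> 'b \<Rightarrow> 'm) \<Rightarrow> ('b \<Rightarrow> 'n::ab_group_add \<Rightarrow> 'n) \<Rightarrow> ('m \<times> 'n \<Rightarrow>\<^sub>0 int) set"
  for r l where
  zero: "0 \<in> tensor_relations r l"
| diff: "u \<in> tensor_relations r l \<Longrightarrow> v \<in> tensor_relations r l \<Longrightarrow> u - v \<in> tensor_relations r l"
| add_left: "frag_of (x + x', y) - (frag_of (x, y) + frag_of (x', y)) \<in> tensor_relations r l"
| add_right: "frag_of (x, y + y') - (frag_of (x, y) + frag_of (x, y')) \<in> tensor_relations r l"
| balanced: "frag_of (r x b, y) - frag_of (x, l b y) \<in> tensor_relations r l"

definition tensor_eq ::
    "('m::ab_group_add \<Rightarrow> 'b \<Rightarrow> 'm) \<Rightarrow> ('b \<Rightarrow> 'n::ab_group_add \<Rightarrow> 'n) \<Rightarrow>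
      ('m \<times> 'n \<Rightarrow>\<^sub>0 int) \<Rightarrow> ('m \<times> 'n \<Rightarrow>\<^sub>0 int) \<Rightarrow> bool" where
  "tensor_eq r l u v \<longleftrightarrow> u - v \<in> tensor_relations r l"

lemma tensor_relations_uminus: "u \<in> tensor_relations r l \<Longrightarrow> - u \<in> tensor_relations r l"
  using tensor_relations.diff[OF tensor_relations.zero] by fastforce

lemma tensor_relations_plus:
  "u \<in> tensor_relations r l \<Longrightarrow> v \<in> tensor_relations r l \<Longrightarrow> u + v \<in> tensor_relations r l"
  using tensor_relations.diff[of u r l "- v"] tensor_relations_uminus[of v r l] by simp

lemma equivp_tensor_eq: "equivp (tensor_eq r l)"
proof (rule equivpI)
  show "reflp (tensor_eq r l)"
    by (simp add: reflp_def tensor_eq_def tensor_relations.zero)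
  show "symp (tensor_eq r l)"
    unfolding symp_def tensor_eq_def using tensor_relations_uminus by fastforce
  show "transp (tensor_eq r l)"
    unfolding transp_def tensor_eq_def using tensor_relations_plus by fastforce
qed

lemma tensor_eq_plus: "tensor_eq r l u u' \<Longrightarrow> tensor_eq r l v v' \<Longrightarrow> tensor_eq r l (u + v) (u' + v')"
  unfolding tensor_eq_def using tensor_relations_plus[of "u - u'" r l "v - v'"]
  by (simp add: algebra_simps)

lemma tensor_eq_minus: "tensor_eq r l u u' \<Longrightarrow> tensor_eq r l v v' \<Longrightarrow> tensor_eq r l (u - v) (u' - v')"
  unfolding tensor_eq_def using tensor_relations.diff[of "u - u'" r l "v - v'"]
  by (simp add: algebra_simps)

lemma tensor_eq_uminus: "tensor_eq r l u u' \<Longrightarrow> tensor_eq r l (- u) (- u')"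
  unfolding tensor_eq_def using tensor_relations_uminus[of "u - u'" r l] by (simp add: algebra_simps)

lemma tensor_eq_map:
  assumes "additive h" "additive k" "\<And>x b. h (r x b) = r (h x) b" "\<And>b y. k (l b y) = l b (k y)"
    and "tensor_eq r l u v"
  shows "tensor_eq r l (frag_extend (\<lambda>(x, y). frag_of (h x, k y)) u)
    (frag_extend (\<lambda>(x, y). frag_of (h x, k y)) v)"
proof -
  have "frag_extend (\<lambda>(x, y). frag_of (h x, k y)) w \<in> tensor_relations r l"
    if "w \<in> tensor_relations r l" for w
    using that
  proof (induction rule: tensor_relations.induct)
    case zero
    then show ?case by (simp add: tensor_relations.zero)
  next
    case (diff u v)
    then show ?case by (simp add: frag_extend_diff tensor_relations.diff)
  next
    case (add_left x x' y)
    then show ?case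
      by (simp add: frag_extend_diff frag_extend_add additive.add[OF assms(1)] tensor_relations.add_left)
  next
    case (add_right x y y')
    then show ?case
      by (simp add: frag_extend_diff frag_extend_add additive.add[OF assms(2)] tensor_relations.add_right)
  next
    case (balanced x b y)
    then show ?case
      by (simp add: frag_extend_diff assms(3,4) tensor_relations.balanced)
  qed
  from this[of "u - v"] assms(5) show ?thesis
    by (simp add: tensor_eq_def frag_extend_diff)
qed

definition int_mult :: "int \<Rightarrow> 'c::ab_group_add \<Rightarrow> 'c" where
  "int_mult k c = (\<Sum>i<nat k. c) - (\<Sum>i<nat (- k). c)"

lemma int_mult_add: "int_mult (k + l) c = int_mult k c + int_mult l c"
proof -
  have add: "(\<Sum>i<m + n. c) = (\<Sum>i<m. c) + (\<Sum>i<n. c)" for m n :: nat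
    by (induction n) (simp_all add: add.assoc)
  have "nat (k + l) + (nat (- k) + nat (- l)) = nat k + nat l + nat (- (k + l))"
    by auto
  then have "(\<Sum>i<nat (k + l). c) + ((\<Sum>i<nat (- k). c) + (\<Sum>i<nat (- l). c))
      = (\<Sum>i<nat k. c) + (\<Sum>i<nat l. c) + (\<Sum>i<nat (- (k + l)). c)"
    by (metis add)
  then show ?thesis
    unfolding int_mult_def by (simp add: algebra_simps)
qed

lemma frag_lift_ex:
  fixes f :: "'p \<Rightarrow> 'c::ab_group_add"
  shows "\<exists>h. additive h \<and> (\<forall>p. h (frag_of p) = f p)"
proof -
  define h where "h u = (\<Sum>p\<in>Poly_Mapping.keys u. int_mult (Poly_Mapping.lookup u p) (f p))" for u
  have h_eq: "h u = (\<Sum>p\<in>A. int_mult (Poly_Mapping.lookup u p) (f p))"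
    if "finite A" "Poly_Mapping.keys u \<subseteq> A" for u A
    unfolding h_def using that
    by (intro sum.mono_neutral_left) (auto simp: in_keys_iff int_mult_def)
  have "h (u + v) = h u + h v" for u v
    using Poly_Mapping.keys_add[of u v]
      h_eq[of "Poly_Mapping.keys u \<union> Poly_Mapping.keys v" u]
      h_eq[of "Poly_Mapping.keys u \<union> Poly_Mapping.keys v" v]
      h_eq[of "Poly_Mapping.keys u \<union> Poly_Mapping.keys v" "u + v"]
    by (simp add: lookup_add int_mult_add sum.distrib)
  moreover have "h (frag_of p) = f p" for p
    by (simp add: h_def int_mult_def)
  ultimately show ?thesis
    by (intro exI[of _ h]) (simp add: additive_def)
qed

lemma tensor_lift_ex:
  fixes \<phi> :: "'m::ab_group_add \<Rightarrow> 'n::ab_group_add \<Rightarrow> 'c::ab_group_add"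
  assumes "\<And>x x' y. \<phi> (x + x') y = \<phi> x y + \<phi> x' y" "\<And>x y y'. \<phi> x (y + y') = \<phi> x y + \<phi> x y'"
    and "\<And>x b y. \<phi> (r x b) y = \<phi> x (l b y)"
  shows "\<exists>h. additive h \<and> (\<forall>x y. h (frag_of (x, y)) = \<phi> x y) \<and> (\<forall>u v. tensor_eq r l u v \<longrightarrow> h u = h v)"
proof -
  obtain h where h: "additive h" "\<And>p. h (frag_of p) = (case p of (x, y) \<Rightarrow> \<phi> x y)"
    using frag_lift_ex[of "\<lambda>(x, y). \<phi> x y"] by blast
  have "h w = 0" if "w \<in> tensor_relations r l" for w
    using that
    by (induction rule: tensor_relations.induct)
      (simp_all add: h(2) additive.add[OF h(1)] additive.diff[OF h(1)] additive.zero[OF h(1)] assms)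
  then have "h u = h v" if "tensor_eq r l u v" for u v
    using that additive.diff[OF h(1), of u v] by (simp add: tensor_eq_def)
  with h show ?thesis
    by (intro exI[of _ h]) simp
qed

subsection \<open>\<open>\<Omega>\<^sup>1 \<otimes>\<^sub>B \<Omega>\<^sup>1\<close>\<close>

quotient_type (overloaded) 'a tensor2 =
    "('a::star_differential_calculus form1 \<times> 'a form1) \<Rightarrow>\<^sub>0 int" / "tensor_eq (\<lhd>) (\<rhd>)"
  by (rule equivp_tensor_eq)

lift_definition tens2 :: "'a::star_differential_calculus form1 \<Rightarrow> 'a form1 \<Rightarrow> 'a tensor2"
    (infixl "\<otimes>\<^sub>2" 70)
  is "\<lambda>x y. frag_of (x, y)" .

instantiation tensor2 :: (star_differential_calculus) ab_group_add
begin

lift_definition zero_tensor2 :: "'a tensor2" is 0 .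
lift_definition plus_tensor2 :: "'a tensor2 \<Rightarrow> 'a tensor2 \<Rightarrow> 'a tensor2" is "(+)"
  by (rule tensor_eq_plus)
lift_definition minus_tensor2 :: "'a tensor2 \<Rightarrow> 'a tensor2 \<Rightarrow> 'a tensor2" is "(-)"
  by (rule tensor_eq_minus)
lift_definition uminus_tensor2 :: "'a tensor2 \<Rightarrow> 'a tensor2" is uminus
  by (rule tensor_eq_uminus)

instance
  by standard (transfer; simp add: algebra_simps tensor_eq_def tensor_relations.zero)+

end

lift_definition lact2 :: "'a::star_differential_calculus form0 \<Rightarrow> 'a tensor2 \<Rightarrow> 'a tensor2"
    (infixr "\<rhd>\<^sub>2" 72)
  is "\<lambda>b. frag_extend (\<lambda>(x, y). frag_of (b \<rhd> x, y))"
  by (rule tensor_eq_map[where k="\<lambda>y. y"])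
    (auto intro!: additive.intro simp: lact_add_right lact_ract)

lift_definition ract2 :: "'a::star_differential_calculus tensor2 \<Rightarrow> 'a form0 \<Rightarrow> 'a tensor2"
    (infixl "\<lhd>\<^sub>2" 72)
  is "\<lambda>u b. frag_extend (\<lambda>(x, y). frag_of (x, y \<lhd> b)) u"
  by (rule tensor_eq_map[where h="\<lambda>x. x"])
    (auto intro!: additive.intro simp: ract_add_left lact_ract)

lemma tens2_add_left: "(x + x') \<otimes>\<^sub>2 y = x \<otimes>\<^sub>2 y + x' \<otimes>\<^sub>2 y"
  by transfer (simp add: tensor_eq_def tensor_relations.add_left)

lemma tens2_add_right: "x \<otimes>\<^sub>2 (y + y') = x \<otimes>\<^sub>2 y + x \<otimes>\<^sub>2 y'"
  by transfer (simp add: tensor_eq_def tensor_relations.add_right)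

lemma tens2_balanced: "(x \<lhd> b) \<otimes>\<^sub>2 y = x \<otimes>\<^sub>2 (b \<rhd> y)"
  by transfer (simp add: tensor_eq_def tensor_relations.balanced)

lemma tensor2_induct [case_names tens diff]:
  assumes "\<And>x y. P (x \<otimes>\<^sub>2 y)" "\<And>s t. P s \<Longrightarrow> P t \<Longrightarrow> P (s - t)"
  shows "P t"
proof -
  have zero: "P (abs_tensor2 0)"
  proof -
    have "abs_tensor2 0 = 0 \<otimes>\<^sub>2 0 - (0 \<otimes>\<^sub>2 0 :: 'a tensor2)"
      by (simp flip: zero_tensor2.abs_eq)
    then show ?thesis using assms by metis
  qed
  have "P (abs_tensor2 u)" for u
    by (rule frag_induction[where S=UNIV and P="\<lambda>u. P (abs_tensor2 u)"])
      (use assms zero in \<open>auto simp flip: tens2.abs_eq minus_tensor2.abs_eq\<close>)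
  then show ?thesis by (metis Quotient3_abs_rep[OF Quotient3_tensor2])
qed

instantiation tensor2 :: (star_differential_calculus) complex_vec
begin

lift_definition scaleC_tensor2 :: "complex \<Rightarrow> 'a tensor2 \<Rightarrow> 'a tensor2"
  is "\<lambda>c. frag_extend (\<lambda>(x, y). frag_of (c *\<^sub>C x, y))"
  by (rule tensor_eq_map[where k="\<lambda>y. y"])
    (auto intro!: additive.intro simp: scaleC_add_right scaleC_ract)

instance
proof
  have diff: "c *\<^sub>C (s - t) = c *\<^sub>C s - c *\<^sub>C t" for c and s t :: "'a tensor2"
    by transfer (simp add: tensor_eq_def frag_extend_diff tensor_relations.zero)
  have tens: "c *\<^sub>C (x \<otimes>\<^sub>2 y) = (c *\<^sub>C x) \<otimes>\<^sub>2 y" for c and x y :: "'a form1"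
    by transfer (simp add: tensor_eq_def tensor_relations.zero)
  fix c c' :: complex and s t :: "'a tensor2"
  show "c *\<^sub>C (s + t) = c *\<^sub>C s + c *\<^sub>C t"
    by transfer (simp add: tensor_eq_def frag_extend_add tensor_relations.zero)
  show "(c + c') *\<^sub>C t = c *\<^sub>C t + c' *\<^sub>C t"
    by (induction t rule: tensor2_induct)
      (simp_all add: tens diff tens2_add_left scaleC_add_left)
  show "c *\<^sub>C (c' *\<^sub>C t) = (c * c') *\<^sub>C t"
    by (induction t rule: tensor2_induct) (simp_all add: tens diff scaleC_scaleC)
  show "1 *\<^sub>C t = t"
    by (induction t rule: tensor2_induct) (simp_all add: tens diff scaleC_one)
qed

end

lifting_forget tensor2.lifting

subsection \<open>\<open>\<Omega>\<^sup>1 \<otimes>\<^sub>B (\<Omega>\<^sup>1 \<otimes>\<^sub>B \<Omega>\<^sup>1)\<close>\<close>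

quotient_type (overloaded) 'a tensor3 =
    "('a::star_differential_calculus form1 \<times> 'a tensor2) \<Rightarrow>\<^sub>0 int" / "tensor_eq (\<lhd>) (\<rhd>\<^sub>2)"
  by (rule equivp_tensor_eq)

lift_definition tens3 :: "'a::star_differential_calculus form1 \<Rightarrow> 'a tensor2 \<Rightarrow> 'a tensor3"
    (infixl "\<otimes>\<^sub>3" 70)
  is "\<lambda>x t. frag_of (x, t)" .

instantiation tensor3 :: (star_differential_calculus) ab_group_add
begin

lift_definition zero_tensor3 :: "'a tensor3" is 0 .
lift_definition plus_tensor3 :: "'a tensor3 \<Rightarrow> 'a tensor3 \<Rightarrow> 'a tensor3" is "(+)"
  by (rule tensor_eq_plus)
lift_definition minus_tensor3 :: "'a tensor3 \<Rightarrow> 'a tensor3 \<Rightarrow> 'a tensor3" is "(-)"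
  by (rule tensor_eq_minus)
lift_definition uminus_tensor3 :: "'a tensor3 \<Rightarrow> 'a tensor3" is uminus
  by (rule tensor_eq_uminus)

instance
  by standard (transfer; simp add: algebra_simps tensor_eq_def tensor_relations.zero)+

end

lemma tensor3_induct [case_names tens diff]:
  assumes "\<And>x t. P (x \<otimes>\<^sub>3 t)" "\<And>s t. P s \<Longrightarrow> P t \<Longrightarrow> P (s - t)"
  shows "P t"
proof -
  have zero: "P (abs_tensor3 0)"
  proof -
    have "abs_tensor3 0 = 0 \<otimes>\<^sub>3 0 - (0 \<otimes>\<^sub>3 0 :: 'a tensor3)"
      by (simp flip: zero_tensor3.abs_eq)
    then show ?thesis using assms by metis
  qed
  have "P (abs_tensor3 u)" for u
    by (rule frag_induction[where S=UNIV and P="\<lambda>u. P (abs_tensor3 u)"])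
      (use assms zero in \<open>auto simp flip: tens3.abs_eq minus_tensor3.abs_eq\<close>)
  then show ?thesis by (metis Quotient3_abs_rep[OF Quotient3_tensor3])
qed

subsection \<open>Maps out of tensor products\<close>

text \<open>\<open>lift2 \<phi>\<close> is the map \<open>\<Sum>\<^sub>i x\<^sub>i \<otimes> y\<^sub>i \<mapsto> \<Sum>\<^sub>i \<phi> x\<^sub>i y\<^sub>i\<close>, and \<open>lift3 \<phi>\<close> likewise. They are
  meaningful only if \<open>\<phi>\<close> is biadditive and \<open>B\<close>-balanced.\<close>

definition lift2 ::
    "('a::star_differential_calculus form1 \<Rightarrow> 'a form1 \<Rightarrow> 'c::ab_group_add) \<Rightarrow> 'a tensor2 \<Rightarrow> 'c" where
  "lift2 \<phi> = (THE h. additive h \<and> (\<forall>x y. h (x \<otimes>\<^sub>2 y) = \<phi> x y))"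

definition lift3 ::
    "('a::star_differential_calculus form1 \<Rightarrow> 'a tensor2 \<Rightarrow> 'c::ab_group_add) \<Rightarrow> 'a tensor3 \<Rightarrow> 'c" where
  "lift3 \<phi> = (THE h. additive h \<and> (\<forall>x t. h (x \<otimes>\<^sub>3 t) = \<phi> x t))"

lemma lift2:
  fixes \<phi> :: "'a::star_differential_calculus form1 \<Rightarrow> 'a form1 \<Rightarrow> 'c::ab_group_add"
  assumes "\<And>x x' y. \<phi> (x + x') y = \<phi> x y + \<phi> x' y" "\<And>x y y'. \<phi> x (y + y') = \<phi> x y + \<phi> x y'"
    and "\<And>x b y. \<phi> (x \<lhd> b) y = \<phi> x (b \<rhd> y)"
  shows "additive (lift2 \<phi>)" and "lift2 \<phi> (x \<otimes>\<^sub>2 y) = \<phi> x y"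
proof -
  obtain h where h: "additive h" "\<And>x y. h (frag_of (x, y)) = \<phi> x y"
    "\<And>u v. tensor_eq (\<lhd>) (\<rhd>) u v \<Longrightarrow> h u = h v"
    using tensor_lift_ex[of \<phi> "(\<lhd>)" "(\<rhd>)"] assms by blast
  define k where "k t = h (rep_tensor2 t)" for t
  have k: "k (abs_tensor2 u) = h u" for u
    unfolding k_def by (rule h(3)) (rule rep_abs_rsp_left[OF Quotient3_tensor2 equivp_reflp[OF equivp_tensor_eq]])
  have "k (s + t) = k s + k t" for s t
  proof -
    have "k (abs_tensor2 (rep_tensor2 s) + abs_tensor2 (rep_tensor2 t)) = k s + k t"
      unfolding plus_tensor2.abs_eq k by (simp add: k_def additive.add[OF h(1)])
    then show ?thesis by (simp add: Quotient3_abs_rep[OF Quotient3_tensor2])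
  qed
  then have "additive k \<and> (\<forall>x y. k (x \<otimes>\<^sub>2 y) = \<phi> x y)"
    by (simp add: additive_def tens2.abs_eq k h(2))
  moreover have "k' = k" if k': "additive k' \<and> (\<forall>x y. k' (x \<otimes>\<^sub>2 y) = \<phi> x y)" for k'
  proof
    fix t show "k' t = k t"
      using k' calculation
      by (induction t rule: tensor2_induct) (simp_all add: additive.diff)
  qed
  ultimately have "additive (lift2 \<phi>) \<and> (\<forall>x y. lift2 \<phi> (x \<otimes>\<^sub>2 y) = \<phi> x y)"
    unfolding lift2_def by (rule theI)
  then show "additive (lift2 \<phi>)" "lift2 \<phi> (x \<otimes>\<^sub>2 y) = \<phi> x y" by auto
qed

lemma lift3:
  fixes \<phi> :: "'a::star_differential_calculus form1 \<Rightarrow> 'a tensor2 \<Rightarrow> 'c::ab_group_add"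
  assumes "\<And>x x' t. \<phi> (x + x') t = \<phi> x t + \<phi> x' t" "\<And>x t t'. \<phi> x (t + t') = \<phi> x t + \<phi> x t'"
    and "\<And>x b t. \<phi> (x \<lhd> b) t = \<phi> x (b \<rhd>\<^sub>2 t)"
  shows "additive (lift3 \<phi>)" and "lift3 \<phi> (x \<otimes>\<^sub>3 t) = \<phi> x t"
proof -
  obtain h where h: "additive h" "\<And>x t. h (frag_of (x, t)) = \<phi> x t"
    "\<And>u v. tensor_eq (\<lhd>) (\<rhd>\<^sub>2) u v \<Longrightarrow> h u = h v"
    using tensor_lift_ex[of \<phi> "(\<lhd>)" "(\<rhd>\<^sub>2)"] assms by blast
  define k where "k t = h (rep_tensor3 t)" for t
  have k: "k (abs_tensor3 u) = h u" for u
    unfolding k_def by (rule h(3)) (rule rep_abs_rsp_left[OF Quotient3_tensor3 equivp_reflp[OF equivp_tensor_eq]])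
  have "k (s + t) = k s + k t" for s t
  proof -
    have "k (abs_tensor3 (rep_tensor3 s) + abs_tensor3 (rep_tensor3 t)) = k s + k t"
      unfolding plus_tensor3.abs_eq k by (simp add: k_def additive.add[OF h(1)])
    then show ?thesis by (simp add: Quotient3_abs_rep[OF Quotient3_tensor3])
  qed
  then have "additive k \<and> (\<forall>x t. k (x \<otimes>\<^sub>3 t) = \<phi> x t)"
    by (simp add: additive_def tens3.abs_eq k h(2))
  moreover have "k' = k" if k': "additive k' \<and> (\<forall>x t. k' (x \<otimes>\<^sub>3 t) = \<phi> x t)" for k'
  proof
    fix t show "k' t = k t"
      using k' calculation
      by (induction t rule: tensor3_induct) (simp_all add: additive.diff)
  qed
  ultimately have "additive (lift3 \<phi>) \<and> (\<forall>x t. lift3 \<phi> (x \<otimes>\<^sub>3 t) = \<phi> x t)"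
    unfolding lift3_def by (rule theI)
  then show "additive (lift3 \<phi>)" "lift3 \<phi> (x \<otimes>\<^sub>3 t) = \<phi> x t" by auto
qed


section \<open>Connections\<close>

definition bimodule_map ::
    "('b \<Rightarrow> 'm \<Rightarrow> 'm) \<Rightarrow> ('m \<Rightarrow> 'b \<Rightarrow> 'm) \<Rightarrow> ('b \<Rightarrow> 'n \<Rightarrow> 'n) \<Rightarrow> ('n \<Rightarrow> 'b \<Rightarrow> 'n) \<Rightarrow>
      ('m::ab_group_add \<Rightarrow> 'n::ab_group_add) \<Rightarrow> bool" where
  "bimodule_map l r l' r' f \<longleftrightarrow>
    additive f \<and> (\<forall>b x. f (l b x) = l' b (f x)) \<and> (\<forall>x b. f (r x b) = r' (f x) b)"

text \<open>The differential is a parameter, since the calculi \<open>(\<Omega>\<^sup>1, d)\<close> and \<open>(\<Omega>\<^sup>1, \<i> d)\<close> are both used.\<close>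

definition left_connection ::
    "('a::star_differential_calculus form0 \<Rightarrow> 'a form1) \<Rightarrow> ('a form1 \<Rightarrow> 'a tensor2) \<Rightarrow> bool" where
  "left_connection \<delta> nabla \<longleftrightarrow>
    Vector_Spaces.linear (*\<^sub>C) (*\<^sub>C) nabla \<and>
    (\<forall>b e. nabla (b \<rhd> e) = b \<rhd>\<^sub>2 nabla e + \<delta> b \<otimes>\<^sub>2 e)"

definition bimodule_connection ::
    "('a::star_differential_calculus form0 \<Rightarrow> 'a form1) \<Rightarrow>
      ('a form1 \<Rightarrow> 'a tensor2) \<Rightarrow> ('a tensor2 \<Rightarrow> 'a tensor2) \<Rightarrow> bool" where
  "bimodule_connection \<delta> nabla \<sigma> \<longleftrightarrow>
    left_connection \<delta> nabla \<and>
    bimodule_map (\<rhd>\<^sub>2) (\<lhd>\<^sub>2) (\<rhd>\<^sub>2) (\<lhd>\<^sub>2) \<sigma> \<and>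
    (\<forall>e b. nabla (e \<lhd> b) = nabla e \<lhd>\<^sub>2 b + \<sigma> (e \<otimes>\<^sub>2 \<delta> b))"

definition star_preserving ::
    "('a::star_differential_calculus form1 \<Rightarrow> 'a tensor2) \<Rightarrow> ('a tensor2 \<Rightarrow> 'a tensor2) \<Rightarrow> bool" where
  "star_preserving nabla \<sigma> \<longleftrightarrow>
    (\<forall>e. nabla (cstar e) = \<sigma> (lift2 (\<lambda>\<omega> e'. cstar e' \<otimes>\<^sub>2 cstar \<omega>) (nabla e)))"

text \<open>\<open>tens21 t z\<close> is \<open>t \<otimes> z\<close> under the identification of \<open>(\<Omega>\<^sup>1 \<otimes>\<^sub>B \<Omega>\<^sup>1) \<otimes>\<^sub>B \<Omega>\<^sup>1\<close> with
  \<open>\<Omega>\<^sup>1 \<otimes>\<^sub>B (\<Omega>\<^sup>1 \<otimes>\<^sub>B \<Omega>\<^sup>1)\<close>, and \<open>tensor_id \<sigma>\<close> is \<open>\<sigma> \<otimes>\<^sub>B id\<close>.\<close>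

definition tens21 :: "'a::star_differential_calculus tensor2 \<Rightarrow> 'a form1 \<Rightarrow> 'a tensor3" where
  "tens21 t z = lift2 (\<lambda>x y. x \<otimes>\<^sub>3 (y \<otimes>\<^sub>2 z)) t"

definition tensor_id ::
    "('a::star_differential_calculus tensor2 \<Rightarrow> 'a tensor2) \<Rightarrow> 'a tensor3 \<Rightarrow> 'a tensor3" where
  "tensor_id \<sigma> = lift3 (\<lambda>x. lift2 (\<lambda>y z. tens21 (\<sigma> (x \<otimes>\<^sub>2 y)) z))"

text \<open>The two summands of \<open>\<nabla> \<otimes> id + (\<sigma> \<otimes> id) (id \<otimes> \<nabla>)\<close> are not separately well defined on
  \<open>\<Omega>\<^sup>1 \<otimes>\<^sub>B \<Omega>\<^sup>1\<close>; only their sum is \<open>B\<close>-balanced.\<close>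

definition induced_connection ::
    "('a::star_differential_calculus form1 \<Rightarrow> 'a tensor2) \<Rightarrow> ('a tensor2 \<Rightarrow> 'a tensor2) \<Rightarrow>
      'a tensor2 \<Rightarrow> 'a tensor3" where
  "induced_connection nabla \<sigma> = lift2 (\<lambda>e f. tens21 (nabla e) f + tensor_id \<sigma> (e \<otimes>\<^sub>3 nabla f))"


section \<open>Metrics\<close>

definition is_metric ::
    "'a::star_differential_calculus tensor2 \<Rightarrow> ('a tensor2 \<Rightarrow> 'a form0) \<Rightarrow> bool" where
  "is_metric g pair \<longleftrightarrow>
    bimodule_map (\<rhd>\<^sub>2) (\<lhd>\<^sub>2) (*) (*) pair \<and>
    (\<forall>\<omega>. lift2 (\<lambda>x y. pair (\<omega> \<otimes>\<^sub>2 x) \<rhd> y) g = \<omega>) \<and>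
    (\<forall>\<omega>. lift2 (\<lambda>x y. x \<lhd> pair (y \<otimes>\<^sub>2 \<omega>)) g = \<omega>)"

definition is_real_metric ::
    "'a::star_differential_calculus tensor2 \<Rightarrow> ('a tensor2 \<Rightarrow> 'a form0) \<Rightarrow> bool" where
  "is_real_metric g pair \<longleftrightarrow>
    is_metric g pair \<and> g = lift2 (\<lambda>x y. cstar y \<otimes>\<^sub>2 cstar x) g"


section \<open>Hermitian connections\<close>

definition sesquilinear_form ::
    "('a::star_differential_calculus form1 \<Rightarrow> 'a form1 \<Rightarrow> 'a form0) \<Rightarrow> bool" where
  "sesquilinear_form herm \<longleftrightarrow>
    (\<forall>f. additive (\<lambda>e. herm e f)) \<and> (\<forall>b e f. herm (b \<rhd> e) f = b * herm e f) \<and>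
    (\<forall>e. additive (herm e)) \<and> (\<forall>c e f. herm e (c *\<^sub>C f) = cnj c *\<^sub>C herm e f) \<and>
    (\<forall>e f. herm e f = cstar (herm f e))"

text \<open>\<open>\<Omega>\<^sup>1\<close> is a direct summand of \<open>B\<^sup>n\<close>, the latter realised as the functions \<open>nat \<Rightarrow> B\<close>
  vanishing from \<open>n\<close> on.\<close>

definition form1_fg_projective :: "'a::star_differential_calculus itself \<Rightarrow> bool" where
  "form1_fg_projective _ \<longleftrightarrow>
    (\<exists>(n::nat) (\<iota> :: 'a form1 \<Rightarrow> nat \<Rightarrow> 'a form0) (\<pi> :: (nat \<Rightarrow> 'a form0) \<Rightarrow> 'a form1).
      (\<forall>x. \<forall>k\<ge>n. \<iota> x k = 0) \<and>
      (\<forall>x y k. \<iota> (x + y) k = \<iota> x k + \<iota> y k) \<and>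
      (\<forall>b x k. \<iota> (b \<rhd> x) k = b * \<iota> x k) \<and>
      (\<forall>v w. (\<forall>k\<ge>n. v k = 0) \<and> (\<forall>k\<ge>n. w k = 0) \<longrightarrow> \<pi> (\<lambda>k. v k + w k) = \<pi> v + \<pi> w) \<and>
      (\<forall>b v. (\<forall>k\<ge>n. v k = 0) \<longrightarrow> \<pi> (\<lambda>k. b * v k) = b \<rhd> \<pi> v) \<and>
      (\<forall>x. \<pi> (\<iota> x) = x))"

definition weak_dagger_bimodule ::
    "('a::star_differential_calculus form1 \<Rightarrow> 'a form1) \<Rightarrow>
      ('a form1 \<Rightarrow> 'a form1 \<Rightarrow> 'a form0) \<Rightarrow> bool" where
  "weak_dagger_bimodule dag herm \<longleftrightarrow>
    form1_fg_projective TYPE('a) \<and>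
    additive dag \<and> (\<forall>c x. dag (c *\<^sub>C x) = cnj c *\<^sub>C dag x) \<and> (\<forall>x. dag (dag x) = x) \<and>
    (\<forall>b x c. dag (b \<rhd> (x \<lhd> c)) = cstar c \<rhd> (dag x \<lhd> cstar b)) \<and>
    sesquilinear_form herm \<and>
    (\<forall>x b y. herm (x \<lhd> b) y = herm x (y \<lhd> cstar b))"

text \<open>The pairings \<open>\<langle>\<langle>\<omega> \<otimes> e, f\<rangle>\<rangle> = \<omega> \<langle>\<langle>e, f\<rangle>\<rangle>\<close> and \<open>\<langle>\<langle>e, \<omega> \<otimes> f\<rangle>\<rangle> = \<langle>\<langle>e, f\<rangle>\<rangle> \<dagger>(\<omega>)\<close>
  with values in \<open>\<Omega>\<^sup>1\<close>.\<close>

definition herm_left ::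
    "('a::star_differential_calculus form1 \<Rightarrow> 'a form1 \<Rightarrow> 'a form0) \<Rightarrow>
      'a tensor2 \<Rightarrow> 'a form1 \<Rightarrow> 'a form1" where
  "herm_left herm t f = lift2 (\<lambda>\<omega> e. \<omega> \<lhd> herm e f) t"

definition herm_right ::
    "('a::star_differential_calculus form1 \<Rightarrow> 'a form1) \<Rightarrow>
      ('a form1 \<Rightarrow> 'a form1 \<Rightarrow> 'a form0) \<Rightarrow> 'a form1 \<Rightarrow> 'a tensor2 \<Rightarrow> 'a form1" where
  "herm_right dag herm e t = lift2 (\<lambda>\<omega> f. herm e f \<rhd> dag \<omega>) t"

definition hermitian_connection ::
    "('a::star_differential_calculus form0 \<Rightarrow> 'a form1) \<Rightarrow> ('a form1 \<Rightarrow> 'a form1) \<Rightarrow>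
      ('a form1 \<Rightarrow> 'a form1 \<Rightarrow> 'a form0) \<Rightarrow> ('a form1 \<Rightarrow> 'a tensor2) \<Rightarrow> bool" where
  "hermitian_connection \<delta> dag herm nabla \<longleftrightarrow>
    weak_dagger_bimodule dag herm \<and> left_connection \<delta> nabla \<and>
    (\<forall>e f. \<delta> (herm e f) = herm_left herm (nabla e) f - herm_right dag herm e (nabla f))"

end

theory Submission
  imports Defs
begin

text \<open>Write \<open>g = \<Sum>\<^sub>i x\<^sub>i \<otimes> y\<^sub>i\<close>. Then \<open>\<nabla>' = \<sigma>\<^sup>-\<^sup>1 \<circ> \<nabla>\<close> is a right connection, and applying the
  isomorphism \<open>\<sigma>\<^sup>-\<^sup>1 \<otimes> id\<close> to \<open>\<nabla> g\<close> gives \<open>G = \<Sum>\<^sub>i \<nabla>'(x\<^sub>i) \<otimes> y\<^sub>i + x\<^sub>i \<otimes> \<nabla>(y\<^sub>i)\<close>. Contracting the outer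
  factors of \<open>G\<close> with forms \<open>e\<close> and \<open>h\<close> yields, by the two Leibniz rules,
  \<open>(e, \<nabla>' h) + (\<nabla> e, h) - d (e, h)\<close>. Such contractions separate the points of the triple tensor
  product, so \<open>G = 0\<close> iff all of these vanish. For \<open>h = f\<^sup>*\<close>, preservation of the star identifies
  \<open>\<nabla>'(f\<^sup>*)\<close> with the flipped star of \<open>\<nabla> f\<close>, which turns the condition into hermiticity of \<open>\<i> \<nabla>\<close>.\<close>

section \<open>Actions, star and differential on forms of degree at most one\<close>

text \<open>Moves identities between forms of degree 0 and 1 into the total algebra: the reversed
  injectivity rules replace an equation by one between representatives, to which the axioms of the
  calculus apply.\<close>

lemmas form_rep_eqs = Rep_form0_inject [symmetric] Rep_form1_inject [symmetric]
  one_form0.rep_eq plus_form0.rep_eq times_form0.rep_eq scaleC_form0.rep_eq cstar_form0.rep_eq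
  plus_form1.rep_eq scaleC_form1.rep_eq cstar_form1.rep_eq lact.rep_eq ract.rep_eq ext_d0.rep_eq

lemma ext_d0_mult: "ext_d0 (a * b) = ext_d0 a \<lhd> b + a \<rhd> ext_d0 b"
  using ext_d_mult[OF Rep_form0, of a "Rep_form0 b"] by (simp add: form_rep_eqs scaleC_one)

lemma additive_ext_d0: "additive ext_d0"
  by (simp add: additive_def form_rep_eqs ext_d_add)

lemma cstar_lact: "cstar (b \<rhd> x) = cstar x \<lhd> cstar b"
  using cstar_mult[OF Rep_form0 Rep_form1, of b x] by (simp add: form_rep_eqs scaleC_one)

lemma cstar_ract: "cstar (x \<lhd> b) = cstar b \<rhd> cstar x"
  using cstar_mult[OF Rep_form1 Rep_form0, of x b] by (simp add: form_rep_eqs scaleC_one)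

lemma cstar_mult_form0: "cstar (a * b) = cstar b * cstar (a :: 'a::star_differential_calculus form0)"
  using cstar_mult[OF Rep_form0 Rep_form0, of a b] by (simp add: form_rep_eqs scaleC_one)

lemma cstar_cstar_form0 [simp]: "cstar (cstar b) = (b :: 'a::star_differential_calculus form0)"
  by (simp add: form_rep_eqs cstar_cstar)

lemma cstar_cstar_form1 [simp]: "cstar (cstar x) = (x :: 'a::star_differential_calculus form1)"
  by (simp add: form_rep_eqs cstar_cstar)

lemma additive_cstar_form0: "additive (cstar :: 'a::star_differential_calculus form0 \<Rightarrow> _)"
  by (simp add: additive_def form_rep_eqs cstar_add)

lemma additive_cstar_form1: "additive (cstar :: 'a::star_differential_calculus form1 \<Rightarrow> _)"
  by (simp add: additive_def form_rep_eqs cstar_add)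

lemma cstar_scaleC_form1: "cstar (c *\<^sub>C x) = cnj c *\<^sub>C cstar (x :: 'a::star_differential_calculus form1)"
  by (simp add: form_rep_eqs cstar_scaleC)

text \<open>Scalars act through multiples of the unit of \<open>B\<close>, so complex linearity can
  be deduced from \<open>B\<close>-linearity and balancing.\<close>

lemma lact_scaleC_one: "(c *\<^sub>C 1) \<rhd> x = c *\<^sub>C x"
  by (simp add: form_rep_eqs mult_scaleC_left)

lemma ract_scaleC_one: "x \<lhd> (c *\<^sub>C 1) = c *\<^sub>C x"
  by (simp add: form_rep_eqs mult_scaleC_right)

lemma lact_scaleC_right: "b \<rhd> (c *\<^sub>C x) = c *\<^sub>C (b \<rhd> x)"
  by (simp add: form_rep_eqs mult_scaleC_right)

lemmas cstar_form1_add = additive.add[OF additive_cstar_form1]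

lemma additive_lact_right: "additive (\<lambda>x. b \<rhd> x)"
  and additive_ract_left: "additive (\<lambda>x. x \<lhd> b)"
  by (simp_all add: additive_def lact_add_right ract_add_left)

lemma additive_scaleC: "additive (\<lambda>x :: 'a::complex_vec. c *\<^sub>C x)"
  by (simp add: additive_def scaleC_add_right)

lemma additive_compose: "additive f \<Longrightarrow> additive g \<Longrightarrow> additive (\<lambda>x. f (g x))"
  by (simp add: additive_def)

section \<open>Tensor calculus\<close>

lemma additive_tens2_left: "additive (\<lambda>x. x \<otimes>\<^sub>2 y)"
  and additive_tens2_right: "additive (\<lambda>y. x \<otimes>\<^sub>2 y)"
  by (simp_all add: additive_def tens2_add_left tens2_add_right)

lemma lact2_tens2: "b \<rhd>\<^sub>2 (x \<otimes>\<^sub>2 y) = (b \<rhd> x) \<otimes>\<^sub>2 y"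
  by (simp add: tens2.abs_eq lact2.abs_eq)

lemma ract2_tens2: "(x \<otimes>\<^sub>2 y) \<lhd>\<^sub>2 b = x \<otimes>\<^sub>2 (y \<lhd> b)"
  by (simp add: tens2.abs_eq ract2.abs_eq)

lemma scaleC_tens2: "c *\<^sub>C (x \<otimes>\<^sub>2 y) = (c *\<^sub>C x) \<otimes>\<^sub>2 y"
  by (simp add: tens2.abs_eq scaleC_tensor2.abs_eq)

lemma lact2_add: "b \<rhd>\<^sub>2 (s + t) = b \<rhd>\<^sub>2 s + b \<rhd>\<^sub>2 t"
  by (induct s rule: tensor2.abs_induct, induct t rule: tensor2.abs_induct)
    (simp add: plus_tensor2.abs_eq lact2.abs_eq frag_extend_add)

lemma ract2_add: "(s + t) \<lhd>\<^sub>2 b = s \<lhd>\<^sub>2 b + t \<lhd>\<^sub>2 b"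
  by (induct s rule: tensor2.abs_induct, induct t rule: tensor2.abs_induct)
    (simp add: plus_tensor2.abs_eq ract2.abs_eq frag_extend_add)

lemma additive_lact2: "additive (\<lambda>t. b \<rhd>\<^sub>2 t)"
  and additive_ract2: "additive (\<lambda>t. t \<lhd>\<^sub>2 b)"
  by (simp_all add: additive_def lact2_add ract2_add)

section \<open>Triple tensors, and equality of additive maps on tensor products\<close>

lemma tens3_add_left: "(x + x') \<otimes>\<^sub>3 t = x \<otimes>\<^sub>3 t + x' \<otimes>\<^sub>3 t"
  by transfer (simp add: tensor_eq_def tensor_relations.add_left)

lemma tens3_add_right: "x \<otimes>\<^sub>3 (t + t') = x \<otimes>\<^sub>3 t + x \<otimes>\<^sub>3 t'"
  by transfer (simp add: tensor_eq_def tensor_relations.add_right)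

lemma tens3_balanced: "(x \<lhd> b) \<otimes>\<^sub>3 t = x \<otimes>\<^sub>3 (b \<rhd>\<^sub>2 t)"
  by transfer (simp add: tensor_eq_def tensor_relations.balanced)

lemma additive_tens3_left: "additive (\<lambda>x. x \<otimes>\<^sub>3 t)"
  and additive_tens3_right: "additive (\<lambda>t. x \<otimes>\<^sub>3 t)"
  by (simp_all add: additive_def tens3_add_left tens3_add_right)

text \<open>Pure tensors generate the tensor product under subtraction. This is the uniqueness half
  of the universal property, with \<open>lift2\<close> as the existence half.\<close>

lemma tensor2_eqI:
  assumes "additive f" "additive g" "\<And>x y. f (x \<otimes>\<^sub>2 y) = g (x \<otimes>\<^sub>2 y)"
  shows "f t = g t"
  by (induction t rule: tensor2_induct) (simp_all add: assms additive.diff)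

lemma tensor3_eqI:
  assumes "additive f" "additive g" "\<And>x y z. f (x \<otimes>\<^sub>3 (y \<otimes>\<^sub>2 z)) = g (x \<otimes>\<^sub>3 (y \<otimes>\<^sub>2 z))"
  shows "f t = g t"
proof (induction t rule: tensor3_induct)
  case (tens x t)
  show ?case
    by (rule tensor2_eqI[where f="\<lambda>t. f (x \<otimes>\<^sub>3 t)" and g="\<lambda>t. g (x \<otimes>\<^sub>3 t)"])
      (use assms in \<open>auto intro: additive_compose additive_tens3_right\<close>)
next
  case (diff s t)
  then show ?case by (simp add: assms additive.diff)
qed

lemma scaleC_tens2_right: "x \<otimes>\<^sub>2 (c *\<^sub>C y) = c *\<^sub>C (x \<otimes>\<^sub>2 y)"
  by (metis lact_scaleC_one ract_scaleC_one scaleC_tens2 tens2_balanced)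

lemma lact2_scaleC: "b \<rhd>\<^sub>2 (c *\<^sub>C t) = c *\<^sub>C (b \<rhd>\<^sub>2 t)"
  by (rule tensor2_eqI[where f="\<lambda>t. b \<rhd>\<^sub>2 (c *\<^sub>C t)"])
    (auto intro: additive_compose additive_lact2 additive_scaleC
      simp: scaleC_tens2 lact2_tens2 lact_scaleC_right)

lemma scaleC_eq_lact2: "c *\<^sub>C t = (c *\<^sub>C 1) \<rhd>\<^sub>2 t"
  by (rule tensor2_eqI[where f="\<lambda>t. c *\<^sub>C t"])
    (auto intro: additive_lact2 additive_scaleC simp: scaleC_tens2 lact2_tens2 lact_scaleC_one)

text \<open>Applied to a metric, this supplies the finite family that serves as a frame.\<close>

lemma tensor2_sum_ex: "\<exists>n x y. t = (\<Sum>i<(n::nat). x i \<otimes>\<^sub>2 y i)"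
proof (induction t rule: tensor2_induct)
  case (tens x y)
  have "x \<otimes>\<^sub>2 y = (\<Sum>i<(1::nat). x \<otimes>\<^sub>2 y)" by simp
  then show ?case by (intro exI[of _ "1::nat"] exI[of _ "\<lambda>_. x"] exI[of _ "\<lambda>_. y"])
next
  case (diff s t)
  then obtain n x y m x' y' where
    s: "s = (\<Sum>i<(n::nat). x i \<otimes>\<^sub>2 y i)" and t: "t = (\<Sum>i<(m::nat). x' i \<otimes>\<^sub>2 y' i)"
    by blast
  \<comment> \<open>The two families are concatenated, and the minus sign of the second is absorbed
    into its left factors.\<close>
  define X where "X i = (if i < n then x i else - x' (i - n))" for i
  define Y where "Y i = (if i < n then y i else y' (i - n))" for i
  have "(\<Sum>i<n + m. X i \<otimes>\<^sub>2 Y i) = (\<Sum>i<n. X i \<otimes>\<^sub>2 Y i) + (\<Sum>i<m. X (n + i) \<otimes>\<^sub>2 Y (n + i))"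
    by (induction m) (simp_all add: add.assoc)
  also have "\<dots> = s - t"
    unfolding s t by (simp add: X_def Y_def additive.minus[OF additive_tens2_left] sum_negf)
  finally show ?case by metis
qed

lemma tens21_tens2: "tens21 (x \<otimes>\<^sub>2 y) z = x \<otimes>\<^sub>3 (y \<otimes>\<^sub>2 z)"
  and additive_tens21_left: "additive (\<lambda>t. tens21 t z)"
  unfolding tens21_def
  by (subst lift2 | simp add: tens3_add_left tens3_add_right tens2_add_left tens3_balanced lact2_tens2)+

lemma additive_tens21_right: "additive (tens21 t)"
proof
  fix z z'
  show "tens21 t (z + z') = tens21 t z + tens21 t z'"
    by (induction t rule: tensor2_induct)
      (simp_all add: tens21_tens2 tens2_add_right tens3_add_right
        additive.diff[OF additive_tens21_left])
qed

text \<open>The balancing relation of the other bracketing, \<open>(\<Omega>\<^sup>1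
  \<otimes>\<^sub>B \<Omega>\<^sup>1) \<otimes>\<^sub>B \<Omega>\<^sup>1\<close>, whose tensor sign
  \<open>tens21\<close> represents.\<close>

lemma tens21_balanced: "tens21 (t \<lhd>\<^sub>2 b) z = tens21 t (b \<rhd> z)"
  by (rule tensor2_eqI[where f="\<lambda>t. tens21 (t \<lhd>\<^sub>2 b) z"])
    (auto intro: additive_compose[of "\<lambda>t. tens21 t z"] additive_tens21_left additive_ract2
      simp: tens21_tens2 ract2_tens2 tens2_balanced)

section \<open>The map \<open>f \<otimes> id\<close> and the induced connection\<close>

abbreviation bimodule_endo2 ::
    "('a::star_differential_calculus tensor2 \<Rightarrow> 'a tensor2) \<Rightarrow> bool" where
  "bimodule_endo2 \<equiv> bimodule_map (\<rhd>\<^sub>2) (\<lhd>\<^sub>2) (\<rhd>\<^sub>2) (\<lhd>\<^sub>2)"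

context
  fixes f :: "'a::star_differential_calculus tensor2 \<Rightarrow> 'a tensor2"
  assumes f: "bimodule_endo2 f"
begin

private lemma f_props: "additive f" "f (t \<lhd>\<^sub>2 b) = f t \<lhd>\<^sub>2 b"
  using f by (auto simp: bimodule_map_def)

text \<open>Two nested lifts have to be justified. The inner one is balanced because
  \<open>f\<close> is right \<open>B\<close>-linear, the outer one because \<open>f\<close> sees
  \<open>x\<close> and \<open>y\<close> only through their tensor product over
  \<open>B\<close>.\<close>

lemma additive_tensor_id: "additive (tensor_id f)"
  and tensor_id_tens3: "tensor_id f (x \<otimes>\<^sub>3 (y \<otimes>\<^sub>2 z)) = tens21 (f (x \<otimes>\<^sub>2 y)) z"
proof -
  define \<phi> where "\<phi> x = lift2 (\<lambda>y z. tens21 (f (x \<otimes>\<^sub>2 y)) z)" for x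
  have \<phi>: "additive (\<phi> x)" "\<phi> x (y \<otimes>\<^sub>2 z) = tens21 (f (x \<otimes>\<^sub>2 y)) z" for x y z
    unfolding \<phi>_def
    by (rule lift2;
      simp add: tens2_add_right additive.add[OF f_props(1)] additive.add[OF additive_tens21_left]
        additive.add[OF additive_tens21_right] f_props(2) flip: tens21_balanced ract2_tens2)+
  have 1: "\<phi> (x + x') t = \<phi> x t + \<phi> x' t" for x x' t
    by (induction t rule: tensor2_induct)
      (simp_all add: \<phi>(2) tens2_add_left additive.add[OF f_props(1)]
        additive.add[OF additive_tens21_left] additive.diff[OF \<phi>(1)])
  have 2: "\<phi> (x \<lhd> b) t = \<phi> x (b \<rhd>\<^sub>2 t)" for x b t
    by (induction t rule: tensor2_induct)
      (simp_all add: \<phi>(2) lact2_tens2 tens2_balanced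
        additive.diff[OF \<phi>(1)] additive.diff[OF additive_lact2])
  note lift = lift3[of \<phi>, OF 1 additive.add[OF \<phi>(1)] 2]
  have "tensor_id f = lift3 \<phi>"
    by (simp add: tensor_id_def \<phi>_def[abs_def])
  with lift show "additive (tensor_id f)" "tensor_id f (x \<otimes>\<^sub>3 (y \<otimes>\<^sub>2 z)) = tens21 (f (x \<otimes>\<^sub>2 y)) z"
    by (simp_all add: \<phi>(2))
qed

lemma tensor_id_tens21: "tensor_id f (tens21 t z) = tens21 (f t) z"
  by (rule tensor2_eqI[where f="\<lambda>t. tensor_id f (tens21 t z)"])
    (auto intro: additive_compose[of "tensor_id f"] additive_compose[of "\<lambda>t. tens21 t z"]
      additive_tensor_id additive_tens21_left f_props simp: tens21_tens2 tensor_id_tens3)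

end

text \<open>Each law may be tested after applying the injective map \<open>f\<close>, where it
  becomes the same law for \<open>f\<close>.\<close>

lemma bimodule_endo2_inv:
  assumes "bimodule_endo2 f" "bij f"
  shows "bimodule_endo2 (inv f)"
proof -
  have [simp]: "f (inv f t) = t" "inv f (f t) = t" for t
    using assms(2) by (simp_all add: bij_is_surj surj_f_inv_f bij_is_inj)
  have f: "f (s + t) = f s + f t" "f (b \<rhd>\<^sub>2 t) = b \<rhd>\<^sub>2 f t" "f (t \<lhd>\<^sub>2 b) = f t \<lhd>\<^sub>2 b" for b s t
    using assms(1) by (simp_all add: bimodule_map_def additive.add)
  show ?thesis
    unfolding bimodule_map_def additive_def
    by (intro conjI allI; rule injD[OF bij_is_inj[OF assms(2)]]) (simp_all add: f)
qed

text \<open>Functoriality of tensoring with the identity. It allows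
  \<open>\<sigma> \<otimes> id\<close> to be cancelled from the induced connection.\<close>

lemma tensor_id_inverse:
  assumes "bimodule_endo2 f" "bij f"
  shows "tensor_id (inv f) (tensor_id f t) = t"
proof -
  note inv = bimodule_endo2_inv[OF assms]
  show ?thesis
    by (rule tensor3_eqI[where f="\<lambda>t. tensor_id (inv f) (tensor_id f t)"])
      (auto intro: additive_compose[of "tensor_id (inv f)"] additive.intro
        simp: additive_tensor_id assms(1) inv tensor_id_tens3 tensor_id_tens21 tens21_tens2
          bij_is_inj[OF assms(2)])
qed

text \<open>The sum of the two terms is balanced because the same extra term
  \<open>\<sigma> (e \<otimes> db) \<otimes> f\<close> arises on one side from the right Leibniz
  rule for \<open>e \<lhd> b\<close> and on the other from the left Leibniz rule for
  \<open>b \<rhd> f\<close>.\<close>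

lemma induced_connection_sum:
  assumes "bimodule_connection ext_d0 nabla \<sigma>"
  shows "induced_connection nabla \<sigma> (\<Sum>i\<in>A. x i \<otimes>\<^sub>2 y i) =
    (\<Sum>i\<in>A. tens21 (nabla (x i)) (y i) + tensor_id \<sigma> (x i \<otimes>\<^sub>3 nabla (y i)))"
proof -
  have \<sigma>: "bimodule_endo2 \<sigma>"
    and nabla: "nabla (e + f) = nabla e + nabla f"
      "nabla (b \<rhd> e) = b \<rhd>\<^sub>2 nabla e + ext_d0 b \<otimes>\<^sub>2 e"
      "nabla (e \<lhd> b) = nabla e \<lhd>\<^sub>2 b + \<sigma> (e \<otimes>\<^sub>2 ext_d0 b)" for e f b
    using assms
    by (auto simp: bimodule_connection_def left_connection_def Vector_Spaces.linear_iff)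
  note add = additive.add[OF additive_tensor_id[OF \<sigma>]]
    additive.add[OF additive_tens21_left] additive.add[OF additive_tens21_right]
  note lift = lift2[of "\<lambda>e f. tens21 (nabla e) f + tensor_id \<sigma> (e \<otimes>\<^sub>3 nabla f)"]
  have "additive (induced_connection nabla \<sigma>)"
    "induced_connection nabla \<sigma> (e \<otimes>\<^sub>2 f) = tens21 (nabla e) f + tensor_id \<sigma> (e \<otimes>\<^sub>3 nabla f)" for e f
    unfolding induced_connection_def
    by (rule lift; simp add: nabla add tens3_add_left tens3_add_right tens21_balanced
        tens3_balanced tensor_id_tens3[OF \<sigma>])+
  then show ?thesis
    by (simp add: additive.sum)
qed

section \<open>Contractions with a metric\<close>

definition contract_left ::
    "('a::star_differential_calculus tensor2 \<Rightarrow> 'a form0) \<Rightarrow> 'a form1 \<Rightarrow> 'a tensor2 \<Rightarrow> 'a form1" where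
  "contract_left pair e = lift2 (\<lambda>u v. pair (e \<otimes>\<^sub>2 u) \<rhd> v)"

definition contract_right ::
    "('a::star_differential_calculus tensor2 \<Rightarrow> 'a form0) \<Rightarrow> 'a form1 \<Rightarrow> 'a tensor2 \<Rightarrow> 'a form1" where
  "contract_right pair h = lift2 (\<lambda>u v. u \<lhd> pair (v \<otimes>\<^sub>2 h))"

text \<open>This is \<open>(e, ) \<otimes> id \<otimes> ( , h)\<close>: only the middle factor
  survives as a form.\<close>

definition contract_outer ::
    "('a::star_differential_calculus tensor2 \<Rightarrow> 'a form0) \<Rightarrow> 'a form1 \<Rightarrow> 'a form1 \<Rightarrow>
      'a tensor3 \<Rightarrow> 'a form1" where
  "contract_outer pair e h = lift3 (\<lambda>u t. pair (e \<otimes>\<^sub>2 u) \<rhd> contract_right pair h t)"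

section \<open>Contractions along a bilinear pairing\<close>

locale bimodule_pairing =
  fixes pair :: "'a::star_differential_calculus tensor2 \<Rightarrow> 'a form0"
  assumes pair: "bimodule_map (\<rhd>\<^sub>2) (\<lhd>\<^sub>2) (*) (*) pair"
begin

lemma additive_pair: "additive pair"
  and pair_lact: "pair ((b \<rhd> u) \<otimes>\<^sub>2 v) = b * pair (u \<otimes>\<^sub>2 v)"
  and pair_ract: "pair (u \<otimes>\<^sub>2 (v \<lhd> b)) = pair (u \<otimes>\<^sub>2 v) * b"
  using pair by (auto simp: bimodule_map_def simp flip: lact2_tens2 ract2_tens2)

lemmas pair_add = additive.add[OF additive_pair]

lemma additive_pair_left: "additive (\<lambda>u. pair (u \<otimes>\<^sub>2 v))"
  by (simp add: additive_def tens2_add_left pair_add)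

lemma pair_scaleC: "pair (c *\<^sub>C t) = c *\<^sub>C pair t"
  using pair by (simp add: bimodule_map_def scaleC_eq_lact2[of c t] mult_scaleC_left)

lemma additive_contract_left: "additive (contract_left pair e)"
  and contract_left_tens2: "contract_left pair e (u \<otimes>\<^sub>2 v) = pair (e \<otimes>\<^sub>2 u) \<rhd> v"
  unfolding contract_left_def
  by (rule lift2;
    simp add: tens2_add_right pair_add lact_add_left lact_add_right pair_ract lact_lact)+

lemma additive_contract_right: "additive (contract_right pair h)"
  and contract_right_tens2: "contract_right pair h (u \<otimes>\<^sub>2 v) = u \<lhd> pair (v \<otimes>\<^sub>2 h)"
  unfolding contract_right_def
  by (rule lift2;
    simp add: tens2_add_left pair_add ract_add_left ract_add_right pair_lact ract_ract)+

lemma contract_left_ract2: "contract_left pair e (t \<lhd>\<^sub>2 b) = contract_left pair e t \<lhd> b"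
  by (rule tensor2_eqI[where f="\<lambda>t. contract_left pair e (t \<lhd>\<^sub>2 b)"])
    (auto intro: additive_compose additive_contract_left additive_ract2 additive_ract_left
      simp: contract_left_tens2 ract2_tens2 lact_ract)

lemma contract_right_lact2: "contract_right pair h (b \<rhd>\<^sub>2 t) = b \<rhd> contract_right pair h t"
  by (rule tensor2_eqI[where f="\<lambda>t. contract_right pair h (b \<rhd>\<^sub>2 t)"])
    (auto intro: additive_compose additive_contract_right additive_lact2 additive_lact_right
      simp: contract_right_tens2 lact2_tens2 lact_ract)

lemma additive_contract_outer: "additive (contract_outer pair e h)"
  and contract_outer_tens3:
    "contract_outer pair e h (u \<otimes>\<^sub>3 t) = pair (e \<otimes>\<^sub>2 u) \<rhd> contract_right pair h t"
  unfolding contract_outer_def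
  by (rule lift3;
    simp add: tens2_add_right pair_add lact_add_left lact_add_right pair_ract lact_lact
      additive.add[OF additive_contract_right] contract_right_lact2)+

lemma contract_outer_tens21:
  "contract_outer pair e h (tens21 t w) = contract_left pair e t \<lhd> pair (w \<otimes>\<^sub>2 h)"
  by (rule tensor2_eqI[where f="\<lambda>t. contract_outer pair e h (tens21 t w)"])
    (auto intro: additive_compose[of "contract_outer pair e h"]
        additive_compose[of "\<lambda>v. v \<lhd> pair (w \<otimes>\<^sub>2 h)"]
        additive_contract_outer additive_tens21_left additive_contract_left additive_ract_left
      simp: tens21_tens2 contract_outer_tens3 contract_left_tens2 contract_right_tens2 lact_ract)

end

text \<open>The inverse property of a metric presented as the sum of the
  \<open>x i \<otimes> y i\<close>. The \<open>y i\<close> generate on the left with coordinates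
  \<open>(\<omega>, x i)\<close>, and the \<open>x i\<close> on the right with coordinates
  \<open>(y i, \<omega>)\<close>.\<close>

locale metric_frame = bimodule_pairing pair
  for pair :: "'a::star_differential_calculus tensor2 \<Rightarrow> 'a form0" +
  fixes n :: nat and x y :: "nat \<Rightarrow> 'a form1"
  assumes expand_left: "(\<Sum>i<n. pair (\<omega> \<otimes>\<^sub>2 x i) \<rhd> y i) = \<omega>"
    and expand_right: "(\<Sum>i<n. x i \<lhd> pair (y i \<otimes>\<^sub>2 \<omega>)) = \<omega>"
begin

text \<open>Expand the first factor in the \<open>x i\<close> and the last in the
  \<open>y j\<close>. Balancing moves all coefficients into the middle factor, where they form the
  outer contraction, so \<open>T\<close> is recovered from its contractions.\<close>

lemma tensor3_expand:
  "T = (\<Sum>i<n. \<Sum>j<n. x i \<otimes>\<^sub>3 (contract_outer pair (y i) (x j) T \<otimes>\<^sub>2 y j))"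
proof (rule tensor3_eqI[where f="\<lambda>T. T"])
  fix u v w
  have "(\<Sum>i<n. \<Sum>j<n. x i \<otimes>\<^sub>3 (contract_outer pair (y i) (x j) (u \<otimes>\<^sub>3 (v \<otimes>\<^sub>2 w)) \<otimes>\<^sub>2 y j))
      = (\<Sum>i<n. \<Sum>j<n. (x i \<lhd> pair (y i \<otimes>\<^sub>2 u)) \<otimes>\<^sub>3 (v \<otimes>\<^sub>2 (pair (w \<otimes>\<^sub>2 x j) \<rhd> y j)))"
    by (simp add: contract_outer_tens3 contract_right_tens2 tens3_balanced lact2_tens2
        tens2_balanced flip: lact_ract)
  also have "\<dots> = u \<otimes>\<^sub>3 (v \<otimes>\<^sub>2 w)"
    by (simp add: expand_left expand_right
        flip: additive.sum[OF additive_tens3_right] additive.sum[OF additive_tens2_right]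
          additive.sum[OF additive_tens3_left])
  finally show "u \<otimes>\<^sub>3 (v \<otimes>\<^sub>2 w) =
      (\<Sum>i<n. \<Sum>j<n. x i \<otimes>\<^sub>3 (contract_outer pair (y i) (x j) (u \<otimes>\<^sub>3 (v \<otimes>\<^sub>2 w)) \<otimes>\<^sub>2 y j))"
    by simp
qed (simp_all add: additive_def additive.add[OF additive_contract_outer] tens2_add_left
    tens3_add_right sum.distrib)

lemma contract_outer_eq_0_iff: "(\<forall>e h. contract_outer pair e h T = 0) \<longleftrightarrow> T = 0"
proof
  assume "\<forall>e h. contract_outer pair e h T = 0"
  then show "T = 0"
    using tensor3_expand[of T]
    by (simp add: additive.zero[OF additive_tens2_left] additive.zero[OF additive_tens3_right])
qed (simp add: additive.zero[OF additive_contract_outer])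

text \<open>Dual basis criterion with generators \<open>y k\<close> and coordinates
  \<open>(\<omega>, x k)\<close>. The coordinates are padded by 0 from \<open>n\<close> on, to land
  in the chosen model of \<open>B\<^sup>n\<close>.\<close>

lemma form1_fg_projective: "form1_fg_projective TYPE('a)"
  unfolding form1_fg_projective_def
proof (rule exI[of _ n], intro exI conjI allI impI)
  let ?\<iota> = "\<lambda>\<omega> k. if k < n then pair (\<omega> \<otimes>\<^sub>2 x k) else 0"
  let ?\<pi> = "\<lambda>v. \<Sum>k<n. v k \<rhd> y k"
  fix \<omega> \<omega>' :: "'a form1" and b k
  show "?\<iota> (\<omega> + \<omega>') k = ?\<iota> \<omega> k + ?\<iota> \<omega>' k"
    by (simp add: tens2_add_left pair_add)
  show "?\<iota> (b \<rhd> \<omega>) k = b * ?\<iota> \<omega> k"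
    by (simp add: pair_lact)
  show "?\<pi> (?\<iota> \<omega>) = \<omega>"
    by (simp add: expand_left)
  fix v w :: "nat \<Rightarrow> 'a form0"
  show "?\<pi> (\<lambda>k. v k + w k) = ?\<pi> v + ?\<pi> w"
    by (simp add: lact_add_left sum.distrib)
  show "?\<pi> (\<lambda>k. b * v k) = b \<rhd> ?\<pi> v"
    by (simp add: additive.sum[OF additive_lact_right] lact_lact)
qed simp

text \<open>Both Leibniz rules move the frame coefficients inside the connections; the error terms add up
  to \<open>d (\<Sum>\<^sub>i (e, x\<^sub>i) (y\<^sub>i, h)) = d (e, h)\<close>.\<close>

lemma contract_outer_connection:
  assumes "additive nabla" "additive nabla'"
    and left: "\<And>b e. nabla (b \<rhd> e) = b \<rhd>\<^sub>2 nabla e + ext_d0 b \<otimes>\<^sub>2 e"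
    and right: "\<And>b e. nabla' (e \<lhd> b) = nabla' e \<lhd>\<^sub>2 b + e \<otimes>\<^sub>2 ext_d0 b"
  shows "contract_outer pair e h (\<Sum>i<n. tens21 (nabla' (x i)) (y i) + x i \<otimes>\<^sub>3 nabla (y i))
    = contract_left pair e (nabla' h) + contract_right pair h (nabla e) - ext_d0 (pair (e \<otimes>\<^sub>2 h))"
proof -
  have "nabla e = nabla (\<Sum>i<n. pair (e \<otimes>\<^sub>2 x i) \<rhd> y i)"
    by (simp add: expand_left)
  also have "\<dots> = (\<Sum>i<n. pair (e \<otimes>\<^sub>2 x i) \<rhd>\<^sub>2 nabla (y i) + ext_d0 (pair (e \<otimes>\<^sub>2 x i)) \<otimes>\<^sub>2 y i)"
    by (simp add: additive.sum[OF assms(1)] left)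
  finally have L: "contract_right pair h (nabla e) =
      (\<Sum>i<n. pair (e \<otimes>\<^sub>2 x i) \<rhd> contract_right pair h (nabla (y i)))
      + (\<Sum>i<n. ext_d0 (pair (e \<otimes>\<^sub>2 x i)) \<lhd> pair (y i \<otimes>\<^sub>2 h))"
    by (simp add: additive.sum[OF additive_contract_right] additive.add[OF additive_contract_right]
        contract_right_lact2 contract_right_tens2 sum.distrib)
  have "nabla' h = nabla' (\<Sum>i<n. x i \<lhd> pair (y i \<otimes>\<^sub>2 h))"
    by (simp add: expand_right)
  also have "\<dots> = (\<Sum>i<n. nabla' (x i) \<lhd>\<^sub>2 pair (y i \<otimes>\<^sub>2 h) + x i \<otimes>\<^sub>2 ext_d0 (pair (y i \<otimes>\<^sub>2 h)))"
    by (simp add: additive.sum[OF assms(2)] right)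
  finally have R: "contract_left pair e (nabla' h) =
      (\<Sum>i<n. contract_left pair e (nabla' (x i)) \<lhd> pair (y i \<otimes>\<^sub>2 h))
      + (\<Sum>i<n. pair (e \<otimes>\<^sub>2 x i) \<rhd> ext_d0 (pair (y i \<otimes>\<^sub>2 h)))"
    by (simp add: additive.sum[OF additive_contract_left] additive.add[OF additive_contract_left]
        contract_left_ract2 contract_left_tens2 sum.distrib)
  have "pair (e \<otimes>\<^sub>2 h) = pair ((\<Sum>i<n. pair (e \<otimes>\<^sub>2 x i) \<rhd> y i) \<otimes>\<^sub>2 h)"
    by (simp add: expand_left)
  also have "\<dots> = (\<Sum>i<n. pair (e \<otimes>\<^sub>2 x i) * pair (y i \<otimes>\<^sub>2 h))"
    by (simp add: additive.sum[OF additive_pair_left] pair_lact)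
  finally have "ext_d0 (pair (e \<otimes>\<^sub>2 h)) =
      (\<Sum>i<n. ext_d0 (pair (e \<otimes>\<^sub>2 x i)) \<lhd> pair (y i \<otimes>\<^sub>2 h))
      + (\<Sum>i<n. pair (e \<otimes>\<^sub>2 x i) \<rhd> ext_d0 (pair (y i \<otimes>\<^sub>2 h)))"
    by (simp add: additive.sum[OF additive_ext_d0] ext_d0_mult sum.distrib)
  \<comment> \<open>The first sums of \<open>L\<close> and \<open>R\<close> are the contraction of
    the two kinds of summands on the left; the second sums are exactly the two halves of
    \<open>ext_d0 (pair (e \<otimes>\<^sub>2 h))\<close>.\<close>
  then show ?thesis
    by (simp add: L R additive.sum[OF additive_contract_outer] sum.distrib
        additive.add[OF additive_contract_outer] contract_outer_tens21 contract_outer_tens3)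
qed

end

section \<open>The Hermitian form of a real metric\<close>

abbreviation star2 :: "'a::star_differential_calculus tensor2 \<Rightarrow> 'a tensor2" where
  "star2 \<equiv> lift2 (\<lambda>u v. cstar v \<otimes>\<^sub>2 cstar u)"

text \<open>The star reverses products and \<open>star2\<close> reverses the factors, so the
  balancing relation is carried to itself.\<close>

lemma additive_star2: "additive star2"
  and star2_tens2: "star2 (u \<otimes>\<^sub>2 v) = cstar v \<otimes>\<^sub>2 cstar u"
  by (rule lift2;
    simp add: cstar_form1_add tens2_add_left tens2_add_right cstar_lact cstar_ract tens2_balanced)+

context metric_frame
begin

lemma cstar_pair:
  assumes real: "(\<Sum>i<n. x i \<otimes>\<^sub>2 y i) = star2 (\<Sum>i<n. x i \<otimes>\<^sub>2 y i)"
  shows "cstar (pair (u \<otimes>\<^sub>2 v)) = pair (cstar v \<otimes>\<^sub>2 cstar u)"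
proof -
  \<comment> \<open>The pairing \<open>(u, v) \<mapsto> (v\<^sup>*, u\<^sup>*)\<^sup>*\<close> is also inverse to the metric, hence equal to \<open>pair\<close>.\<close>
  have "(\<Sum>i<n. cstar (y i) \<lhd> pair (cstar (x i) \<otimes>\<^sub>2 v))
      = contract_right pair v (star2 (\<Sum>i<n. x i \<otimes>\<^sub>2 y i))"
    by (simp add: additive.sum[OF additive_star2] star2_tens2
        additive.sum[OF additive_contract_right] contract_right_tens2)
  also have "\<dots> = v"
    by (simp add: additive.sum[OF additive_contract_right] contract_right_tens2 expand_right
        flip: real)
  finally have "cstar (\<Sum>i<n. cstar (y i) \<lhd> pair (cstar (x i) \<otimes>\<^sub>2 v)) = cstar v"
    by (rule arg_cong)
  then have v: "cstar v = (\<Sum>i<n. cstar (pair (cstar (x i) \<otimes>\<^sub>2 v)) \<rhd> y i)"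
    by (simp add: additive.sum[OF additive_cstar_form1] cstar_ract)
  \<comment> \<open>Expanding \<open>cstar u\<close> and starring back writes \<open>u\<close> in
    the \<open>cstar (x i)\<close>. Pairing these with \<open>v\<close> reproduces, after a further
    star, the coefficients of \<open>cstar v\<close> found above.\<close>
  have "u = cstar (\<Sum>i<n. x i \<lhd> pair (y i \<otimes>\<^sub>2 cstar u))"
    by (simp add: expand_right)
  also have "\<dots> = (\<Sum>i<n. cstar (pair (y i \<otimes>\<^sub>2 cstar u)) \<rhd> cstar (x i))"
    by (simp add: additive.sum[OF additive_cstar_form1] cstar_ract)
  finally have "cstar (pair (u \<otimes>\<^sub>2 v)) =
      cstar (pair ((\<Sum>i<n. cstar (pair (y i \<otimes>\<^sub>2 cstar u)) \<rhd> cstar (x i)) \<otimes>\<^sub>2 v))"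
    by (rule arg_cong)
  also have "\<dots> = (\<Sum>i<n. cstar (pair (cstar (x i) \<otimes>\<^sub>2 v)) * pair (y i \<otimes>\<^sub>2 cstar u))"
    by (simp add: additive.sum[OF additive_pair_left] pair_lact cstar_mult_form0
        additive.sum[OF additive_cstar_form0])
  also have "\<dots> = pair (cstar v \<otimes>\<^sub>2 cstar u)"
    by (simp add: additive.sum[OF additive_pair_left] pair_lact v)
  finally show ?thesis .
qed

text \<open>Reality of the metric enters through \<open>cstar_pair\<close>, which gives the
  Hermitian symmetry. Compatibility with right multiplication is balancing, and projectivity comes
  from the frame.\<close>

lemma weak_dagger_bimodule_cstar:
  assumes "(\<Sum>i<n. x i \<otimes>\<^sub>2 y i) = star2 (\<Sum>i<n. x i \<otimes>\<^sub>2 y i)"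
  shows "weak_dagger_bimodule cstar (\<lambda>\<eta> \<omega>. pair (\<eta> \<otimes>\<^sub>2 cstar \<omega>))"
  unfolding weak_dagger_bimodule_def sesquilinear_form_def
  by (auto intro: form1_fg_projective
      simp: cstar_scaleC_form1 cstar_lact cstar_ract lact_ract tens2_balanced pair_lact
        cstar_pair[OF assms] scaleC_tens2_right pair_scaleC additive_def tens2_add_left
        tens2_add_right cstar_form1_add pair_add)

lemma contract_left_scaleC: "contract_left pair e (c *\<^sub>C t) = c *\<^sub>C contract_left pair e t"
  by (rule tensor2_eqI[where f="\<lambda>t. contract_left pair e (c *\<^sub>C t)"])
    (auto intro: additive_compose[of "contract_left pair e"] additive_compose[of "\<lambda>v. c *\<^sub>C v"]
        additive_contract_left additive_scaleC
      simp: contract_left_tens2 lact_scaleC_right simp flip: scaleC_tens2_right)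

lemma contract_right_scaleC: "contract_right pair h (c *\<^sub>C t) = c *\<^sub>C contract_right pair h t"
  by (simp add: scaleC_eq_lact2 contract_right_lact2 lact_scaleC_one)

lemma star2_scaleC: "star2 (c *\<^sub>C t) = cnj c *\<^sub>C star2 t"
  by (rule tensor2_eqI[where f="\<lambda>t. star2 (c *\<^sub>C t)"])
    (auto intro: additive_compose[of star2] additive_compose[of "\<lambda>v. cnj c *\<^sub>C v"]
        additive_star2 additive_scaleC
      simp: star2_tens2 scaleC_tens2 cstar_scaleC_form1 scaleC_tens2_right)

section \<open>The Hermitian condition in terms of contractions\<close>

lemma herm_left_eq: "herm_left (\<lambda>\<eta> \<omega>. pair (\<eta> \<otimes>\<^sub>2 cstar \<omega>)) t f = contract_right pair (cstar f) t"
  by (simp add: herm_left_def contract_right_def)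

text \<open>The form stars the second factor of a tensor and the dagger stars the first. Together
  they amount to \<open>star2\<close>, and what remains is a left contraction.\<close>

lemma herm_right_eq:
  "herm_right cstar (\<lambda>\<eta> \<omega>. pair (\<eta> \<otimes>\<^sub>2 cstar \<omega>)) e t = contract_left pair e (star2 t)"
proof (rule tensor2_eqI[where g="\<lambda>t. contract_left pair e (star2 t)"])
  let ?\<phi> = "\<lambda>\<omega> f. pair (e \<otimes>\<^sub>2 cstar f) \<rhd> cstar \<omega>"
  have "additive (lift2 ?\<phi>)" "lift2 ?\<phi> (u \<otimes>\<^sub>2 v) = ?\<phi> u v" for u v
    by (rule lift2;
      simp add: cstar_form1_add tens2_add_right pair_add lact_add_left lact_add_right
        cstar_lact cstar_ract pair_ract lact_lact)+
  then show "additive (herm_right cstar (\<lambda>\<eta> \<omega>. pair (\<eta> \<otimes>\<^sub>2 cstar \<omega>)) e)"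
    "herm_right cstar (\<lambda>\<eta> \<omega>. pair (\<eta> \<otimes>\<^sub>2 cstar \<omega>)) e (u \<otimes>\<^sub>2 v)
      = contract_left pair e (star2 (u \<otimes>\<^sub>2 v))" for u v
    by (simp_all add: herm_right_def[abs_def] contract_left_tens2 star2_tens2)
  show "additive (\<lambda>t. contract_left pair e (star2 t))"
    by (rule additive_compose[OF additive_contract_left additive_star2])
qed

text \<open>The second pairing is antilinear in the connection and contributes
  \<open>cnj \<i> = - \<i>\<close>. With the minus sign of the Hermitian condition all three terms
  carry the factor \<open>\<i>\<close>, which cancels, and the difference becomes a sum.\<close>

lemma hermitian_connection_iff:
  assumes "(\<Sum>i<n. x i \<otimes>\<^sub>2 y i) = star2 (\<Sum>i<n. x i \<otimes>\<^sub>2 y i)" "left_connection ext_d0 nabla"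
  shows "hermitian_connection (\<lambda>b. \<i> *\<^sub>C ext_d0 b) cstar
      (\<lambda>\<eta> \<omega>. pair (\<eta> \<otimes>\<^sub>2 cstar \<omega>)) (\<lambda>e. \<i> *\<^sub>C nabla e) \<longleftrightarrow>
    (\<forall>e f. ext_d0 (pair (e \<otimes>\<^sub>2 cstar f)) =
      contract_left pair e (star2 (nabla f)) + contract_right pair (cstar f) (nabla e))"
proof -
  have nabla: "vector_space ((*\<^sub>C) :: complex \<Rightarrow> 'a form1 \<Rightarrow> _)"
      "vector_space ((*\<^sub>C) :: complex \<Rightarrow> 'a tensor2 \<Rightarrow> _)"
      "nabla (u + v) = nabla u + nabla v" "nabla (c *\<^sub>C u) = c *\<^sub>C nabla u"
      "nabla (b \<rhd> u) = b \<rhd>\<^sub>2 nabla u + ext_d0 b \<otimes>\<^sub>2 u" for u v c b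
    using assms(2) by (simp_all only: left_connection_def Vector_Spaces.linear_iff)
  have "left_connection (\<lambda>b. \<i> *\<^sub>C ext_d0 b) (\<lambda>e. \<i> *\<^sub>C nabla e)"
    unfolding left_connection_def Vector_Spaces.linear_iff
    by (simp only: nabla scaleC_add_right scaleC_scaleC mult.commute[of _ \<i>] lact2_scaleC
        scaleC_tens2 simp_thms)
  moreover have "\<i> *\<^sub>C a = \<i> *\<^sub>C r - (cnj \<i> *\<^sub>C l) \<longleftrightarrow> a = l + r" for a r l :: "'a form1"
  proof -
    have "\<i> *\<^sub>C r - (cnj \<i> *\<^sub>C l) = \<i> *\<^sub>C (l + r)"
      using scaleC_scaleC[of "-1" \<i> l, symmetric] by (simp add: scaleC_add_right scaleC_minus_one)
    moreover have "\<i> *\<^sub>C a = \<i> *\<^sub>C b \<longleftrightarrow> a = b" for b :: "'a form1"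
      using scaleC_scaleC[of "- \<i>" \<i>] by (metis scaleC_one i_squared minus_minus mult_minus_left)
    ultimately show ?thesis by simp
  qed
  ultimately show ?thesis
    unfolding hermitian_connection_def herm_left_eq herm_right_eq
    using weak_dagger_bimodule_cstar[OF assms(1)]
    by (simp only: contract_right_scaleC star2_scaleC contract_left_scaleC simp_thms)
qed

end

section \<open>Equivalence of metric compatibility and hermiticity\<close>

theorem theorem3p11:
  fixes g :: "'a::star_differential_calculus tensor2"
    and pair :: "'a tensor2 \<Rightarrow> 'a form0"
    and nabla :: "'a form1 \<Rightarrow> 'a tensor2"
    and \<sigma> :: "'a tensor2 \<Rightarrow> 'a tensor2"
  assumes "is_real_metric g pair"
    and "bimodule_connection ext_d0 nabla \<sigma>"
    and "star_preserving nabla \<sigma>"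
    and "bij \<sigma>"
  shows "induced_connection nabla \<sigma> g = 0 \<longleftrightarrow>
    hermitian_connection (\<lambda>b. \<i> *\<^sub>C ext_d0 b) cstar
      (\<lambda>\<eta> \<omega>. pair (\<eta> \<otimes>\<^sub>2 cstar \<omega>)) (\<lambda>e. \<i> *\<^sub>C nabla e)"
proof -
  obtain n x y where g: "g = (\<Sum>i<(n::nat). x i \<otimes>\<^sub>2 y i)"
    using tensor2_sum_ex by blast
  have pair: "bimodule_map (\<rhd>\<^sub>2) (\<lhd>\<^sub>2) (*) (*) pair"
    and inverse: "contract_left pair \<omega> g = \<omega>" "contract_right pair \<omega> g = \<omega>"
    and real: "g = star2 g" for \<omega>
    using assms(1)
    by (simp_all add: is_real_metric_def is_metric_def contract_left_def contract_right_def)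
  interpret bimodule_pairing pair
    using pair by unfold_locales
  \<comment> \<open>Evaluated termwise on this presentation of \<open>g\<close>, the metric axioms
    become the frame conditions.\<close>
  interpret metric_frame pair n x y
  proof
    show "(\<Sum>i<n. pair (\<omega> \<otimes>\<^sub>2 x i) \<rhd> y i) = \<omega>" "(\<Sum>i<n. x i \<lhd> pair (y i \<otimes>\<^sub>2 \<omega>)) = \<omega>" for \<omega>
      using inverse[of \<omega>]
      by (simp_all add: g additive.sum[OF additive_contract_left] contract_left_tens2
          additive.sum[OF additive_contract_right] contract_right_tens2)
  qed
  have \<sigma>: "bimodule_endo2 \<sigma>"
    and nabla: "left_connection ext_d0 nabla" "additive nabla"
      "nabla (b \<rhd> e) = b \<rhd>\<^sub>2 nabla e + ext_d0 b \<otimes>\<^sub>2 e"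
      "nabla (e \<lhd> b) = nabla e \<lhd>\<^sub>2 b + \<sigma> (e \<otimes>\<^sub>2 ext_d0 b)" for e b
    using assms(2)
    by (auto simp: bimodule_connection_def left_connection_def Vector_Spaces.linear_iff
        additive_def)
  have inv_\<sigma>: "bimodule_endo2 (inv \<sigma>)"
    using \<sigma> assms(4) by (rule bimodule_endo2_inv)
  then have inv_\<sigma>_add: "additive (inv \<sigma>)" and inv_\<sigma>_ract: "inv \<sigma> (t \<lhd>\<^sub>2 b) = inv \<sigma> t \<lhd>\<^sub>2 b" for t b
    by (auto simp: bimodule_map_def)
  have inv_\<sigma>_\<sigma>: "inv \<sigma> (\<sigma> t) = t" for t
    using assms(4) by (simp add: bij_is_inj)
  \<comment> \<open>Composing with \<open>inv \<sigma>\<close> turns the twisted term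
    \<open>\<sigma> (e \<otimes>\<^sub>2 ext_d0 b)\<close> into
    \<open>e \<otimes>\<^sub>2 ext_d0 b\<close>, which makes \<open>nabla'\<close> a right
    connection.\<close>
  define nabla' where "nabla' e = inv \<sigma> (nabla e)" for e
  have nabla': "additive nabla'" "nabla' (e \<lhd> b) = nabla' e \<lhd>\<^sub>2 b + e \<otimes>\<^sub>2 ext_d0 b" for e b
    using nabla(2) inv_\<sigma>_add
    by (auto simp: nabla'_def nabla(4) inv_\<sigma>_ract inv_\<sigma>_\<sigma> additive_def)
  \<comment> \<open>Preservation of the star says that \<open>nabla (cstar f)\<close> is
    \<open>\<sigma>\<close> of \<open>star2 (nabla f)\<close>; applying \<open>inv \<sigma>\<close>
    leaves \<open>nabla'\<close>.\<close>
  have star: "star2 (nabla f) = nabla' (cstar f)" for f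
    using assms(3) by (simp add: star_preserving_def nabla'_def inv_\<sigma>_\<sigma>)
  define G where "G = (\<Sum>i<n. tens21 (nabla' (x i)) (y i) + x i \<otimes>\<^sub>3 nabla (y i))"
  have "tensor_id (inv \<sigma>) (induced_connection nabla \<sigma> g) = G"
    by (simp add: g G_def induced_connection_sum[OF assms(2)] nabla'_def
        additive.sum[OF additive_tensor_id[OF inv_\<sigma>]] additive.add[OF additive_tensor_id[OF inv_\<sigma>]]
        tensor_id_tens21[OF inv_\<sigma>] tensor_id_inverse[OF \<sigma> assms(4)])
  \<comment> \<open>This composite makes \<open>tensor_id (inv \<sigma>)\<close> injective, so
    vanishing of \<open>G\<close> forces vanishing of the induced connection on
    \<open>g\<close>.\<close>
  moreover have "tensor_id \<sigma> (tensor_id (inv \<sigma>) T) = T" for T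
    using tensor_id_inverse[OF inv_\<sigma> bij_imp_bij_inv[OF assms(4)]] by (simp add: inv_inv_eq assms(4))
  ultimately have "induced_connection nabla \<sigma> g = 0 \<longleftrightarrow> G = 0"
    by (metis additive.zero additive_tensor_id \<sigma> inv_\<sigma>)
  also have "\<dots> \<longleftrightarrow> (\<forall>e h. contract_outer pair e h G = 0)"
    by (simp only: contract_outer_eq_0_iff)
  \<comment> \<open>The star is an involution, so every form \<open>h\<close> is of the form
    \<open>cstar f\<close>.\<close>
  also have "\<dots> \<longleftrightarrow> (\<forall>e f. contract_outer pair e (cstar f) G = 0)"
    by (metis cstar_cstar_form1)
  also have "\<dots> \<longleftrightarrow> (\<forall>e f. ext_d0 (pair (e \<otimes>\<^sub>2 cstar f)) =
      contract_left pair e (star2 (nabla f)) + contract_right pair (cstar f) (nabla e))"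
    by (auto simp: G_def contract_outer_connection[OF nabla(2) nabla'(1) nabla(3) nabla'(2)] star)
  also have "\<dots> \<longleftrightarrow> hermitian_connection (\<lambda>b. \<i> *\<^sub>C ext_d0 b) cstar
      (\<lambda>\<eta> \<omega>. pair (\<eta> \<otimes>\<^sub>2 cstar \<omega>)) (\<lambda>e. \<i> *\<^sub>C nabla e)"
    by (rule hermitian_connection_iff[OF real[unfolded g] nabla(1), symmetric])
  finally show ?thesis .
qed

end
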